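(* Let $\mu\in\mathbb R$, $\sigma>0$, $x\ge 0$, $\delta\ge 0$, and let $X$ be the reflected Brownian motion on $[0,\infty)$ with drift $\mu$ and volatility $\sigma$, started at $X_0=x$. Let $$\tau_\delta:=\inf\{t\ge 0\mid X_t=x+\delta\}.$$ Then for every $\theta\ge 0$ the Laplace transform of the first hitting time $\tau_\delta$ is given by $$\mathbb E\left[e^{-\theta\tau_\delta}\mid X_0=x\right]=e^{\frac{\delta\mu}{\sigma^2}}\,\frac{\sqrt{\mu^2+2\theta\sigma^2}\,\cosh\left(\frac{x\sqrt{\mu^2+2\theta\sigma^2}}{\sigma^2}\right)+\mu\,\sinh\left(\frac{x\sqrt{\mu^2+2\theta\sigma^2}}{\sigma^2}\right)}{\sqrt{\mu^2+2\theta\sigma^2}\,\cosh\left(\frac{(x+\delta)\sqrt{\mu^2+2\theta\sigma^2}}{\sigma^2}\right)+\mu\,\sinh\left(\frac{(x+\delta)\sqrt{\mu^2+2\theta\sigma^2}}{\sigma^2}\right)},$$ where, in the degenerate case $\mu=\theta=0$, the right-hand side (formally $0/0$) is understood as its limit value $1$.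
   Context: The reflected Brownian motion on $[0,\infty)$ with drift $\mu$ and volatility $\sigma$, started at $x\ge 0$, is the process $X_t=|\xi^x_t|$, $t\ge 0$, where $\xi^x$ is the unique strong solution of $$d\xi_t=\mu\,\mathrm{sign}(\xi_t)\,dt+\sigma\,dB_t,\qquad \xi_0=x,$$ and $B$ is a standard Brownian motion on a given filtered probability space. Equivalently, $X_t=x+\mu t+\sigma\int_0^t\mathrm{sign}(\xi_s)\,dB_s+L^0_t(X)$, where $L^0(X)$ is the local time of $X$ at $0$. The convention $e^{-\theta\tau_\delta}=0$ on $\{\tau_\delta=\infty\}$ is used for $\theta>0$. *)

theory Defs
  imports "HOL-Probability.Probability"
begin

(* Time is the real half-line: processes and filtrations are families over real of which
   only the indices t >= 0 matter.  (The library's locale filtration would also constrain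
   the negative indices.)  The usual conditions are not required. *)
locale filtered_prob_space = prob_space M for M :: "'a measure" +
  fixes F :: "real \<Rightarrow> 'a measure"
  assumes subalgebra_F: "0 \<le> t \<Longrightarrow> subalgebra M (F t)"
    and mono_F: "0 \<le> s \<Longrightarrow> s \<le> t \<Longrightarrow> sets (F s) \<subseteq> sets (F t)"
begin

definition adapted :: "(real \<Rightarrow> 'a \<Rightarrow> real) \<Rightarrow> bool" where
  "adapted X \<longleftrightarrow> (\<forall>t\<ge>0. X t \<in> borel_measurable (F t))"

definition brownian_motion :: "(real \<Rightarrow> 'a \<Rightarrow> real) \<Rightarrow> bool" where
  "brownian_motion B \<longleftrightarrow>
     adapted B \<and>
     (AE \<omega> in M. B 0 \<omega> = 0) \<and>
     (AE \<omega> in M. continuous_on {0..} (\<lambda>t. B t \<omega>)) \<and>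
     (\<forall>s t. 0 \<le> s \<and> s < t \<longrightarrow>
        distributed M lborel (\<lambda>\<omega>. B t \<omega> - B s \<omega>) (normal_density 0 (sqrt (t - s))) \<and>
        indep_set (sets (F s))
          (sets (vimage_algebra (space M) (\<lambda>\<omega>. B t \<omega> - B s \<omega>) borel)))"

(* The diffusion coefficient is constant, so the stochastic integral in the integral form
   of the SDE is just \<sigma> (B_t - B_0) = \<sigma> B_t.  The library's sgn has sgn 0 = 0; the value
   of the sign at 0 is immaterial, since \<xi> almost surely spends Lebesgue-null time at 0.
   Continuity is required of every path (rather than almost every one) because M need not be
   complete, and hitting times would otherwise not have to be measurable. *)
definition sde_solution ::
  "(real \<Rightarrow> 'a \<Rightarrow> real) \<Rightarrow> real \<Rightarrow> real \<Rightarrow> real \<Rightarrow> (real \<Rightarrow> 'a \<Rightarrow> real) \<Rightarrow> bool" where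
  "sde_solution B \<mu> \<sigma> x \<xi> \<longleftrightarrow>
     adapted \<xi> \<and>
     (\<forall>\<omega>\<in>space M. continuous_on {0..} (\<lambda>t. \<xi> t \<omega>)) \<and>
     (AE \<omega> in M. \<forall>t\<ge>0.
        \<xi> t \<omega> = x + \<mu> * (LBINT s:{0..t}. sgn (\<xi> s \<omega>)) + \<sigma> * B t \<omega>)"

definition reflected_brownian_motion ::
  "(real \<Rightarrow> 'a \<Rightarrow> real) \<Rightarrow> real \<Rightarrow> real \<Rightarrow> real \<Rightarrow> (real \<Rightarrow> 'a \<Rightarrow> real) \<Rightarrow> bool" where
  "reflected_brownian_motion B \<mu> \<sigma> x X \<longleftrightarrow>
     (\<exists>\<xi>. sde_solution B \<mu> \<sigma> x \<xi> \<and> (\<forall>t\<ge>0. \<forall>\<omega>\<in>space M. X t \<omega> = \<bar>\<xi> t \<omega>\<bar>))"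

end

(* The infimum is taken in the extended reals, so it is \<infinity> if the level is never attained. *)
definition hitting_time :: "(real \<Rightarrow> 'a \<Rightarrow> real) \<Rightarrow> real \<Rightarrow> 'a \<Rightarrow> ereal" where
  "hitting_time X a \<omega> = Inf (ereal ` {t. 0 \<le> t \<and> X t \<omega> = a})"

(* exp (- \<theta> \<tau>) for \<theta> >= 0 and \<tau> in [0,\<infinity>]; at \<tau> = \<infinity> it is 0 if \<theta> > 0, and exp 0 = 1 if \<theta> = 0. *)
definition exp_discount :: "real \<Rightarrow> ereal \<Rightarrow> real" where
  "exp_discount \<theta> \<tau> =
     (if \<tau> = \<infinity> then (if \<theta> > 0 then 0 else 1) else exp (- \<theta> * real_of_ereal \<tau>))"

end

theory Submission
  imports Defs "HOL-Real_Asymp.Real_Asymp"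
begin

text \<open>
  Put \<open>a = x + \<delta>\<close> and \<open>r = sqrt (\<mu>\<^sup>2 + 2 * \<theta> * \<sigma>\<^sup>2)\<close>.  For \<open>\<theta> > 0\<close> the even function
  \<open>g y = exp (- \<mu> * \<bar>y\<bar> / \<sigma>\<^sup>2) * (r * cosh (\<bar>y\<bar> * r / \<sigma>\<^sup>2) + \<mu> * sinh (\<bar>y\<bar> * r / \<sigma>\<^sup>2))\<close>
  solves \<open>\<sigma>\<^sup>2 / 2 * g'' + \<mu> * sgn y * g' = \<theta> * g\<close>.  Its derivative vanishes at \<open>0\<close> (reflection), so
  \<open>g\<close> is twice continuously differentiable on the whole line with a locally Lipschitz second
  derivative, although the drift jumps at \<open>0\<close>.  Hence \<open>exp (- \<theta> * t) * g (\<xi> t)\<close>, stopped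
  when \<open>\<bar>\<xi>\<bar>\<close> reaches \<open>a\<close>, has constant expectation, which gives
  \<open>E (exp (- \<theta> * \<tau>)) * g a = g x\<close>.  For \<open>\<theta> = 0\<close> or \<open>\<delta> = 0\<close> both
  sides of the claim are \<open>1\<close>.

  The constancy of the expectation is proved without stochastic integrals, by a discretisation
  with step \<open>h\<close>.  On an event \<open>A\<close> of the past at time \<open>t\<close> on which \<open>\<bar>\<xi> t\<bar> < a\<close>, a second
  order Taylor expansion shows that the expected one-step change of \<open>exp (- \<theta> * t) * g (\<xi> t)\<close>
  is \<open>O(h powr (3 / 2))\<close> uniformly in \<open>t\<close> and \<open>A\<close> (\<open>one_step_expectation\<close>): the first and second order
  martingale terms vanish by independence of the Brownian increment, and the generator
  equation cancels the terms of order \<open>h\<close>.  The only delicate term is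
  \<open>g' (\<xi> t) * (sgn (\<xi> s) - sgn (\<xi> t))\<close>; it is nonzero only if \<open>\<xi>\<close> changes sign between \<open>t\<close> and
  \<open>s\<close>, and then \<open>\<bar>g' (\<xi> t)\<bar> \<le> C * \<bar>\<xi> t\<bar> \<le> C * \<bar>\<xi> s - \<xi> t\<bar>\<close>, so the jump of the drift costs no more than
  the oscillation of \<open>\<xi>\<close> (\<open>drift_error\<close>).  Summing over the grid times before the hitting time
  (\<open>Z_expectation\<close>) and letting \<open>h = 1 / m ^ 4\<close> with \<open>m ^ 5\<close> steps, so that the horizon \<open>m\<close> tends to
  infinity while the total error \<open>m ^ 5 * (1 / m ^ 6)\<close> tends to \<open>0\<close>, dominated convergence gives
  the identity (\<open>Laplace_transform\<close>).
\<close>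

section \<open>Solutions of the generator equation\<close>

lemma filterlim_abs_at_0: "filterlim (abs :: real \<Rightarrow> real) (at 0) (at 0)"
  unfolding filterlim_at by (auto simp: eventually_at_filter intro!: tendsto_eq_intros)

text \<open>The condition at \<open>0\<close> is what makes the even extension differentiable there.\<close>

lemma DERIV_even_extension:
  fixes G G1 :: "real \<Rightarrow> real"
  assumes G: "\<And>y. (G has_real_derivative G1 y) (at y)" and G1_0: "G1 0 = 0"
  shows "((\<lambda>y. G \<bar>y\<bar>) has_real_derivative sgn y * G1 \<bar>y\<bar>) (at y)"
proof -
  consider "y > 0" | "y < 0" | "y = 0" by linarith
  then show ?thesis
  proof cases
    case 1
    have "(G has_real_derivative sgn y * G1 \<bar>y\<bar>) (at y)" using G[of y] 1 by simp
    then show ?thesis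
      by (rule has_field_derivative_transform_within_open[where S="{0<..}"]) (use 1 in auto)
  next
    case 2
    have "(uminus has_real_derivative -1) (at y)" by (auto intro!: derivative_eq_intros)
    from DERIV_chain2[of G "G1 (- y)" uminus y, OF G this]
    have "((\<lambda>y. G (- y)) has_real_derivative sgn y * G1 \<bar>y\<bar>) (at y)" using 2 by simp
    then show ?thesis
      by (rule has_field_derivative_transform_within_open[where S="{..<0}"]) (use 2 in auto)
  next
    case 3
    have "((\<lambda>h. (G h - G 0) / h) \<longlongrightarrow> 0) (at 0)"
      using G[of 0] G1_0 by (simp add: DERIV_def)
    from tendsto_norm[OF filterlim_compose[OF this filterlim_abs_at_0]]
    have "((\<lambda>h. norm ((G \<bar>h\<bar> - G 0) / h)) \<longlongrightarrow> 0) (at 0)"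
      by (simp add: abs_divide)
    then have "((\<lambda>h. (G \<bar>h\<bar> - G 0) / h) \<longlongrightarrow> 0) (at 0)"
      by (rule tendsto_norm_zero_cancel)
    then show ?thesis using 3 by (simp add: DERIV_def)
  qed
qed

lemma DERIV_odd_extension:
  fixes H H1 :: "real \<Rightarrow> real"
  assumes H: "\<And>y. (H has_real_derivative H1 y) (at y)" and H_0: "H 0 = 0"
  shows "((\<lambda>y. sgn y * H \<bar>y\<bar>) has_real_derivative H1 \<bar>y\<bar>) (at y)"
proof -
  consider "y > 0" | "y < 0" | "y = 0" by linarith
  then show ?thesis
  proof cases
    case 1
    have "(H has_real_derivative H1 \<bar>y\<bar>) (at y)" using H[of y] 1 by simp
    then show ?thesis
      by (rule has_field_derivative_transform_within_open[where S="{0<..}"]) (use 1 in auto)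
  next
    case 2
    have "((\<lambda>y. - H (- y)) has_real_derivative H1 \<bar>y\<bar>) (at y)"
      using 2 by (auto intro!: derivative_eq_intros DERIV_chain2[OF H])
    then show ?thesis
      by (rule has_field_derivative_transform_within_open[where S="{..<0}"]) (use 2 in auto)
  next
    case 3
    have "((\<lambda>h. H h / h) \<longlongrightarrow> H1 0) (at 0)"
      using H[of 0] H_0 by (simp add: DERIV_def)
    from filterlim_compose[OF this filterlim_abs_at_0]
    have "((\<lambda>h. sgn h * H \<bar>h\<bar> / h) \<longlongrightarrow> H1 0) (at 0)"
      by (rule Lim_transform_eventually)
        (auto simp: eventually_at_filter sgn_if)
    then show ?thesis using 3 by (simp add: DERIV_def)
  qed
qed

lemma Taylor2_lipschitz:
  fixes g g1 g2 :: "real \<Rightarrow> real"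
  assumes S: "convex S" "y \<in> S" "z \<in> S"
    and g: "\<And>w. w \<in> S \<Longrightarrow> (g has_real_derivative g1 w) (at w)"
    and g1: "\<And>w. w \<in> S \<Longrightarrow> (g1 has_real_derivative g2 w) (at w)"
    and lip: "\<And>v w. v \<in> S \<Longrightarrow> w \<in> S \<Longrightarrow> \<bar>g2 v - g2 w\<bar> \<le> L * \<bar>v - w\<bar>"
    and L: "L \<ge> 0"
  shows "\<bar>g z - g y - g1 y * (z - y) - g2 y * (z - y)\<^sup>2 / 2\<bar> \<le> L * \<bar>z - y\<bar> ^ 3"
proof -
  let ?I = "closed_segment y z"
  have sub: "?I \<subseteq> S" using S by (simp add: closed_segment_subset)
  have d: "\<bar>w - y\<bar> \<le> \<bar>z - y\<bar>" if "w \<in> ?I" for w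
    using that by (auto simp: closed_segment_eq_real_ivl split: if_splits)
  have yI: "y \<in> ?I" and zI: "z \<in> ?I" by auto
  have 1: "\<bar>g1 w - g1 y - g2 y * (w - y)\<bar> \<le> L * \<bar>z - y\<bar>\<^sup>2" if w: "w \<in> ?I" for w
  proof -
    have "norm ((g1 w - g2 y * w) - (g1 y - g2 y * y)) \<le> (L * \<bar>z - y\<bar>) * norm (w - y)"
    proof (rule field_differentiable_bound[of ?I, OF _ _ _ w yI])
      fix v assume v: "v \<in> ?I"
      show "((\<lambda>w. g1 w - g2 y * w) has_real_derivative g2 v - g2 y) (at v within ?I)"
        using v sub by (auto intro!: derivative_eq_intros has_field_derivative_at_within[OF g1])
      have "\<bar>g2 v - g2 y\<bar> \<le> L * \<bar>v - y\<bar>" using v sub S by (intro lip) auto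
      also have "\<dots> \<le> L * \<bar>z - y\<bar>" using d[OF v] L by (intro mult_left_mono)
      finally show "norm (g2 v - g2 y) \<le> L * \<bar>z - y\<bar>" by simp
    qed simp
    also have "\<dots> \<le> (L * \<bar>z - y\<bar>) * \<bar>z - y\<bar>"
      using d[OF w] L by (intro mult_left_mono) auto
    finally show ?thesis by (simp add: algebra_simps power2_eq_square)
  qed
  have "norm ((g z - g1 y * z - g2 y * (z - y)\<^sup>2 / 2) - (g y - g1 y * y - g2 y * (y - y)\<^sup>2 / 2))
      \<le> (L * \<bar>z - y\<bar>\<^sup>2) * norm (z - y)"
  proof (rule field_differentiable_bound[of ?I, OF _ _ _ zI yI])
    fix w assume w: "w \<in> ?I"
    show "((\<lambda>w. g w - g1 y * w - g2 y * (w - y)\<^sup>2 / 2) has_real_derivative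
        g1 w - g1 y - g2 y * (w - y)) (at w within ?I)"
      using w sub by (auto intro!: derivative_eq_intros has_field_derivative_at_within[OF g])
    show "norm (g1 w - g1 y - g2 y * (w - y)) \<le> L * \<bar>z - y\<bar>\<^sup>2" using 1[OF w] by simp
  qed simp
  then show ?thesis by (simp add: algebra_simps power2_eq_square power3_eq_cube)
qed

text \<open>
  A bounded continuous function \<open>u\<close> that solves the generator equation with eigenvalue \<open>\<theta>\<close> on
  the open interval \<open>(- a, a)\<close>, where \<open>u1\<close> and \<open>u2\<close> are its first two derivatives.  Instead of
  differentiability, the locale records the second order Taylor bound from base points inside the interval;
  the increment \<open>d\<close> is arbitrary, so that a step may leave the interval.  All constants are merged
  into the single bound \<open>C\<close>.
\<close>

locale test_function =
  fixes \<mu> \<sigma> \<theta> a C :: real and u u1 u2 :: "real \<Rightarrow> real"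
  assumes C_nonneg: "C \<ge> 0"
    and u_cont: "continuous_on UNIV u"
    and u_bound: "\<bar>u y\<bar> \<le> C"
    and u1_meas [measurable]: "u1 \<in> borel_measurable borel"
    and u2_meas [measurable]: "u2 \<in> borel_measurable borel"
    and u1_bound: "\<bar>y\<bar> < a \<Longrightarrow> \<bar>u1 y\<bar> \<le> C * \<bar>y\<bar>"
    and u2_bound: "\<bar>y\<bar> < a \<Longrightarrow> \<bar>u2 y\<bar> \<le> C"
    and Taylor: "\<bar>y\<bar> < a \<Longrightarrow> \<bar>u (y + d) - u y - u1 y * d - u2 y * d\<^sup>2 / 2\<bar> \<le> C * \<bar>d\<bar> ^ 3"
    and generator: "\<bar>y\<bar> < a \<Longrightarrow> \<sigma>\<^sup>2 / 2 * u2 y + \<mu> * sgn y * u1 y = \<theta> * u y"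

text \<open>
  The function \<open>G\<close> below is the solution on the half-line, written as a combination of two
  exponentials.  Its even extension is made constant beyond \<open>\<bar>y\<bar> = a + 1\<close> so that it is bounded: the Taylor bound
  survives, because an increment that crosses from \<open>(- a, a)\<close> to the constant region
  has length at least \<open>1\<close>, so that every term is dominated by a multiple of its cube.
\<close>

lemma exists_test_function:
  fixes \<mu> \<sigma> \<theta> a :: real
  assumes pos: "\<sigma> > 0" "\<theta> > 0" "a > 0"
  defines "r \<equiv> sqrt (\<mu>\<^sup>2 + 2 * \<theta> * \<sigma>\<^sup>2)"
  obtains C u u1 u2 where "test_function \<mu> \<sigma> \<theta> a C u u1 u2"
    and "\<And>y. \<bar>y\<bar> \<le> a \<Longrightarrow> u y = exp (- \<mu> * \<bar>y\<bar> / \<sigma>\<^sup>2) *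
         (r * cosh (\<bar>y\<bar> * r / \<sigma>\<^sup>2) + \<mu> * sinh (\<bar>y\<bar> * r / \<sigma>\<^sup>2))"
proof -
  define \<alpha> \<beta> where "\<alpha> = (r - \<mu>) / \<sigma>\<^sup>2" and "\<beta> = (r + \<mu>) / \<sigma>\<^sup>2"
  have "\<bar>\<mu>\<bar> < r" unfolding r_def
    using pos by (intro real_less_rsqrt) (auto simp: power2_abs)
  then have ab: "\<alpha> > 0" "\<beta> > 0" using pos by (auto simp: \<alpha>_def \<beta>_def)
  have r2: "r\<^sup>2 = \<mu>\<^sup>2 + 2 * \<theta> * \<sigma>\<^sup>2" unfolding r_def using pos by simp
  have "(r + \<mu>) * \<alpha> = (r\<^sup>2 - \<mu>\<^sup>2) / \<sigma>\<^sup>2" "(r - \<mu>) * \<beta> = (r\<^sup>2 - \<mu>\<^sup>2) / \<sigma>\<^sup>2"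
    by (auto simp: \<alpha>_def \<beta>_def power2_eq_square algebra_simps)
  then have prod: "(r + \<mu>) * \<alpha> = 2 * \<theta>" "(r - \<mu>) * \<beta> = 2 * \<theta>" using r2 pos by auto
  define G where "G y = ((r + \<mu>) * exp (\<alpha> * y) + (r - \<mu>) * exp (- \<beta> * y)) / 2" for y
  define G1 where "G1 y = \<theta> * (exp (\<alpha> * y) - exp (- \<beta> * y))" for y
  define G2 where "G2 y = \<theta> * (\<alpha> * exp (\<alpha> * y) + \<beta> * exp (- \<beta> * y))" for y
  define G3 where "G3 y = \<theta> * (\<alpha>\<^sup>2 * exp (\<alpha> * y) - \<beta>\<^sup>2 * exp (- \<beta> * y))" for y
  have dG: "(G has_real_derivative G1 y) (at y)" for y
  proof -
    have "(G has_real_derivative ((r + \<mu>) * \<alpha> * exp (\<alpha> * y) - (r - \<mu>) * \<beta> * exp (- \<beta> * y)) / 2) (at y)"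
      unfolding G_def by (rule derivative_eq_intros refl | simp)+
    moreover have "(2 * \<theta> * exp (\<alpha> * y) - 2 * \<theta> * exp (- \<beta> * y)) / 2 = G1 y"
      unfolding G1_def by (simp add: field_simps)
    ultimately show ?thesis unfolding prod by metis
  qed
  have dG1: "(G1 has_real_derivative G2 y) (at y)" for y
    unfolding G1_def G2_def by (auto intro!: derivative_eq_intros simp: algebra_simps)
  have dG2: "(G2 has_real_derivative G3 y) (at y)" for y
    unfolding G2_def G3_def by (auto intro!: derivative_eq_intros simp: algebra_simps power2_eq_square)
  have G1_0: "G1 0 = 0" by (simp add: G1_def)
  have contG: "continuous_on A G" "continuous_on A G1" "continuous_on A G2" "continuous_on A G3" for A
    unfolding G_def G1_def G2_def G3_def by (intro continuous_intros; simp)+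
  define b where "b = a + 1"
  obtain K where K: "K \<ge> 0"
    "\<And>y. y \<in> {0..b} \<Longrightarrow> \<bar>G y\<bar> \<le> K" "\<And>y. y \<in> {0..b} \<Longrightarrow> \<bar>G2 y\<bar> \<le> K" "\<And>y. y \<in> {0..b} \<Longrightarrow> \<bar>G3 y\<bar> \<le> K"
  proof -
    have "\<exists>K. \<forall>y\<in>{0..b}. \<bar>f y\<bar> \<le> K" if "continuous_on {0..b} f" for f :: "real \<Rightarrow> real"
      using compact_imp_bounded[OF compact_continuous_image[OF that]] by (auto simp: bounded_iff)
    from this[OF contG(1)] this[OF contG(3)] this[OF contG(4)]
    obtain K0 K2 K3 where *: "\<And>y. y \<in> {0..b} \<Longrightarrow> \<bar>G y\<bar> \<le> K0"
      "\<And>y. y \<in> {0..b} \<Longrightarrow> \<bar>G2 y\<bar> \<le> K2" "\<And>y. y \<in> {0..b} \<Longrightarrow> \<bar>G3 y\<bar> \<le> K3"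
      by blast
    show ?thesis
      by (rule that[of "max 0 (max K0 (max K2 K3))"]) (use *(1) *(2) *(3) in \<open>auto simp: le_max_iff_disj\<close>)
  qed
  have lipG: "\<bar>f v - f w\<bar> \<le> K * \<bar>v - w\<bar>"
    if "\<And>y. (f has_real_derivative f' y) (at y)" "\<And>y. y \<in> {0..b} \<Longrightarrow> \<bar>f' y\<bar> \<le> K" "v \<in> {0..b}" "w \<in> {0..b}"
    for f f' :: "real \<Rightarrow> real" and v w
    using field_differentiable_bound[of "{0..b}" f f' K v w] that
    by (auto intro: has_field_derivative_at_within)
  define u where "u y = G (min \<bar>y\<bar> b)" for y
  define u1 where "u1 y = sgn y * G1 \<bar>y\<bar>" for y
  define u2 where "u2 y = G2 \<bar>y\<bar>" for y
  have bpos: "b > 0" using pos by (simp add: b_def)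
  have ub: "\<bar>u y\<bar> \<le> K" for y using K(2)[of "min \<bar>y\<bar> b"] bpos by (auto simp: u_def)
  have u2b: "\<bar>u2 y\<bar> \<le> K" if "\<bar>y\<bar> \<le> b" for y using K(3) that by (auto simp: u2_def)
  have u1b: "\<bar>u1 y\<bar> \<le> K * \<bar>y\<bar>" if "\<bar>y\<bar> \<le> b" for y
    using lipG[OF dG1 K(3), of "\<bar>y\<bar>" 0] that bpos G1_0 by (auto simp: u1_def abs_mult sgn_if)
  have taylor_in: "\<bar>u z - u y - u1 y * (z - y) - u2 y * (z - y)\<^sup>2 / 2\<bar> \<le> K * \<bar>z - y\<bar> ^ 3"
    if "\<bar>y\<bar> \<le> b" "\<bar>z\<bar> \<le> b" for y z
  proof -
    have "\<bar>G \<bar>z\<bar> - G \<bar>y\<bar> - u1 y * (z - y) - u2 y * (z - y)\<^sup>2 / 2\<bar> \<le> K * \<bar>z - y\<bar> ^ 3"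
    proof (rule Taylor2_lipschitz[where S="{-b..b}" and g="\<lambda>y. G \<bar>y\<bar>"])
      show "((\<lambda>y. G \<bar>y\<bar>) has_real_derivative u1 w) (at w)" for w
        unfolding u1_def by (rule DERIV_even_extension[OF dG G1_0])
      show "(u1 has_real_derivative u2 w) (at w)" for w
        unfolding u1_def u2_def by (rule DERIV_odd_extension[OF dG1 G1_0])
      fix v w assume "v \<in> {-b..b}" "w \<in> {-b..b}"
      then have "\<bar>G2 \<bar>v\<bar> - G2 \<bar>w\<bar>\<bar> \<le> K * \<bar>\<bar>v\<bar> - \<bar>w\<bar>\<bar>" by (intro lipG[OF dG2 K(4)]) auto
      also have "\<dots> \<le> K * \<bar>v - w\<bar>" using K(1) by (intro mult_left_mono) auto
      finally show "\<bar>u2 v - u2 w\<bar> \<le> K * \<bar>v - w\<bar>" by (simp add: u2_def)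
    qed (use that K in auto)
    then show ?thesis using that by (simp add: u_def min_absorb1)
  qed
  define C where "C = 4 * K + K * a"
  have CK: "K \<le> C" using K(1) pos by (simp add: C_def)
  show ?thesis
  proof (rule that)
    show "test_function \<mu> \<sigma> \<theta> a C u u1 u2"
    proof
      show "C \<ge> 0" using K(1) pos by (simp add: C_def)
      show "continuous_on UNIV u" unfolding u_def G_def by (intro continuous_intros) simp_all
      show "\<bar>u y\<bar> \<le> C" for y using ub[of y] CK by linarith
      have [measurable]: "G1 \<in> borel_measurable borel" "G2 \<in> borel_measurable borel"
        using contG by (auto intro: borel_measurable_continuous_onI)
      show "u1 \<in> borel_measurable borel" "u2 \<in> borel_measurable borel"
        unfolding u1_def u2_def by measurable
    next
      fix y d :: real assume y: "\<bar>y\<bar> < a"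
      then have yb: "\<bar>y\<bar> \<le> b" by (simp add: b_def)
      show "\<bar>u1 y\<bar> \<le> C * \<bar>y\<bar>" using u1b[OF yb] mult_right_mono[OF CK, of "\<bar>y\<bar>"] by simp
      show "\<bar>u2 y\<bar> \<le> C" using u2b[OF yb] CK by simp
      show "\<bar>u (y + d) - u y - u1 y * d - u2 y * d\<^sup>2 / 2\<bar> \<le> C * \<bar>d\<bar> ^ 3"
      proof (cases "\<bar>y + d\<bar> \<le> b")
        case True
        then show ?thesis using taylor_in[OF yb True] mult_right_mono[OF CK, of "\<bar>d\<bar>^3"] by simp
      next
        case False
        then have d: "\<bar>d\<bar> \<ge> 1" using y by (simp add: b_def)
        have p: "\<bar>d\<bar> \<le> \<bar>d\<bar>^3" "d\<^sup>2 \<le> \<bar>d\<bar>^3" "1 \<le> \<bar>d\<bar>^3"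
          using d power_increasing[of 1 3 "\<bar>d\<bar>"] power_increasing[of 2 3 "\<bar>d\<bar>"] by auto
        have "\<bar>u1 y * d\<bar> \<le> (K * a) * \<bar>d\<bar>^3"
        proof -
          have "\<bar>u1 y\<bar> \<le> K * a" using u1b[OF yb] mult_left_mono[of "\<bar>y\<bar>" a K] y K(1) by linarith
          then show ?thesis unfolding abs_mult using p by (intro mult_mono) (auto intro: order_trans[rotated])
        qed
        moreover have "\<bar>u2 y * d\<^sup>2\<bar> \<le> K * \<bar>d\<bar>^3"
          unfolding abs_mult using p u2b[OF yb] K(1) by (intro mult_mono) auto
        moreover have "\<bar>u (y+d)\<bar> \<le> K * \<bar>d\<bar>^3" "\<bar>u y\<bar> \<le> K * \<bar>d\<bar>^3"
          using ub[of y] ub[of "y+d"] mult_left_mono[OF p(3) K(1)] by auto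
        moreover have "C * \<bar>d\<bar>^3 = 4 * (K * \<bar>d\<bar>^3) + K * a * \<bar>d\<bar>^3" by (simp add: C_def algebra_simps)
        moreover have "0 \<le> K * \<bar>d\<bar>^3" using K(1) by simp
        ultimately show ?thesis by linarith
      qed
      have ode: "\<sigma>\<^sup>2 / 2 * G2 w + \<mu> * G1 w = \<theta> * G w" for w
      proof -
        have ab2: "\<sigma>\<^sup>2 * \<alpha> = r - \<mu>" "\<sigma>\<^sup>2 * \<beta> = r + \<mu>" using pos by (auto simp: \<alpha>_def \<beta>_def)
        have "\<sigma>\<^sup>2 / 2 * G2 w + \<mu> * G1 w = \<theta> * (((\<sigma>\<^sup>2 * \<alpha>) / 2 + \<mu>) * exp (\<alpha> * w) + ((\<sigma>\<^sup>2 * \<beta>) / 2 - \<mu>) * exp (- \<beta> * w))"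
          by (simp add: G2_def G1_def algebra_simps)
        also have "\<dots> = \<theta> * G w" unfolding ab2 G_def by (simp add: field_simps)
        finally show ?thesis .
      qed
      have "sgn y * u1 y = G1 \<bar>y\<bar>" using G1_0 by (auto simp: u1_def sgn_if)
      then show "\<sigma>\<^sup>2 / 2 * u2 y + \<mu> * sgn y * u1 y = \<theta> * u y"
        using ode[of "\<bar>y\<bar>"] yb by (simp add: u2_def u_def min_absorb1 mult.assoc)
    qed
  next
    fix y :: real assume y: "\<bar>y\<bar> \<le> a"
    define w where "w = \<bar>y\<bar>"
    have e: "exp (\<alpha> * w) = exp (- \<mu> * w / \<sigma>\<^sup>2) * exp (w * r / \<sigma>\<^sup>2)" "exp (- \<beta> * w) = exp (- \<mu> * w / \<sigma>\<^sup>2) * exp (- (w * r / \<sigma>\<^sup>2))"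
      by (auto simp: \<alpha>_def \<beta>_def exp_add[symmetric] field_simps diff_divide_distrib[symmetric])
    have "u y = G w" using y by (simp add: u_def b_def w_def min_absorb1)
    also have "\<dots> = exp (- \<mu> * w / \<sigma>\<^sup>2) * (r * cosh (w * r / \<sigma>\<^sup>2) + \<mu> * sinh (w * r / \<sigma>\<^sup>2))"
      unfolding G_def e cosh_def sinh_def by (simp add: field_simps)
    finally show "u y = exp (- \<mu> * \<bar>y\<bar> / \<sigma>\<^sup>2) * (r * cosh (\<bar>y\<bar> * r / \<sigma>\<^sup>2) + \<mu> * sinh (\<bar>y\<bar> * r / \<sigma>\<^sup>2))"
      by (simp add: w_def)
  qed
qed

section \<open>Continuous processes and Brownian increments\<close>

text \<open>Joint measurability in path and time, by sampling the path on ever finer grids.\<close>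

lemma measurable_continuous_process:
  fixes f :: "real \<Rightarrow> 'a \<Rightarrow> real"
  assumes meas: "\<And>s. f s \<in> borel_measurable M"
    and cont: "\<And>\<omega>. \<omega> \<in> space M \<Longrightarrow> continuous_on UNIV (\<lambda>s. f s \<omega>)"
  shows "(\<lambda>(\<omega>, s). f s \<omega>) \<in> borel_measurable (M \<Otimes>\<^sub>M borel)"
proof (rule borel_measurable_LIMSEQ_real)
  define k where "k n s = of_int \<lfloor>s * real (Suc n)\<rfloor> / real (Suc n)" for n and s :: real
  show "(\<lambda>(\<omega>, s). f (k n s) \<omega>) \<in> borel_measurable (M \<Otimes>\<^sub>M borel)" for n
  proof -
    have "(\<lambda>p. f (of_int \<lfloor>snd p * real (Suc n)\<rfloor> / real (Suc n)) (fst p))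
        \<in> borel_measurable (M \<Otimes>\<^sub>M borel)"
      by (rule measurable_compose_countable[where f="\<lambda>i p. f (of_int i / real (Suc n)) (fst p)"
            and g="\<lambda>p. \<lfloor>snd p * real (Suc n)\<rfloor>"]) (use meas in measurable)
    then show ?thesis by (simp add: k_def case_prod_beta')
  qed
  fix p assume "p \<in> space (M \<Otimes>\<^sub>M (borel :: real measure))"
  then obtain \<omega> s where p: "p = (\<omega>, s)" "\<omega> \<in> space M" by (auto simp: space_pair_measure)
  have "(\<lambda>n. k n s) \<longlonglongrightarrow> s"
  proof (rule real_tendsto_sandwich)
    show "\<forall>\<^sub>F n in sequentially. s - 1 / real (Suc n) \<le> k n s"
    proof (intro always_eventually allI)
      fix n
      have "s * real (Suc n) - 1 \<le> of_int \<lfloor>s * real (Suc n)\<rfloor>" by linarith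
      then have "(s * real (Suc n) - 1) / real (Suc n) \<le> k n s"
        unfolding k_def by (intro divide_right_mono) auto
      then show "s - 1 / real (Suc n) \<le> k n s" by (simp add: diff_divide_distrib)
    qed
    show "\<forall>\<^sub>F n in sequentially. k n s \<le> s"
      unfolding k_def by (intro always_eventually allI) (simp add: divide_le_eq)
    show "(\<lambda>n. s - 1 / real (Suc n)) \<longlonglongrightarrow> s"
      using tendsto_diff[OF tendsto_const LIMSEQ_inverse_real_of_nat, of s] by (simp add: inverse_eq_divide)
  qed auto
  moreover have "isCont (\<lambda>s. f s \<omega>) s" using cont[OF p(2)] by (simp add: continuous_on_eq_continuous_at)
  ultimately show "(\<lambda>n. (case p of (\<omega>, s) \<Rightarrow> f (k n s) \<omega>)) \<longlonglongrightarrow> (case p of (\<omega>, s) \<Rightarrow> f s \<omega>)"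
    unfolding p by (auto intro: isCont_tendsto_compose[of s "\<lambda>s. f s \<omega>"])
qed

context filtered_prob_space
begin

lemma space_F: "0 \<le> t \<Longrightarrow> space (F t) = space M"
  using subalgebra_F by (auto simp: subalgebra_def)

lemma sets_F: "0 \<le> t \<Longrightarrow> A \<in> sets (F t) \<Longrightarrow> A \<in> sets M"
  using subalgebra_F by (auto simp: subalgebra_def)

lemma measurable_F: "0 \<le> t \<Longrightarrow> f \<in> borel_measurable (F t) \<Longrightarrow> f \<in> borel_measurable M"
  using measurable_from_subalg subalgebra_F by blast

lemma measurable_F_mono:
  "0 \<le> s \<Longrightarrow> s \<le> t \<Longrightarrow> f \<in> borel_measurable (F s) \<Longrightarrow> f \<in> borel_measurable (F t)"
  by (rule measurable_from_subalg[of "F t" "F s"])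
     (use mono_F[of s t] space_F[of s] space_F[of t] in \<open>auto simp: subalgebra_def\<close>)

context
  fixes B :: "real \<Rightarrow> 'a \<Rightarrow> real" and s t :: real
  assumes B: "brownian_motion B" and st: "0 \<le> s" "s < t"
begin

lemma increment_distributed:
  "distributed M lborel (\<lambda>\<omega>. B t \<omega> - B s \<omega>) (normal_density 0 (sqrt (t - s)))"
  using B st by (auto simp: brownian_motion_def)

lemma increment_measurable: "(\<lambda>\<omega>. B t \<omega> - B s \<omega>) \<in> borel_measurable M"
  using distributed_measurable[OF increment_distributed] by simp

lemma increment_moment_integrable: "integrable M (\<lambda>\<omega>. \<bar>B t \<omega> - B s \<omega>\<bar> ^ k)"
  using distributed_integrable[OF increment_distributed, of "\<lambda>x. \<bar>x\<bar> ^ k"]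
    integrable_normal_moment_abs[of "sqrt (t - s)" 0 k] st by simp

lemma increment_moments:
  shows "expectation (\<lambda>\<omega>. B t \<omega> - B s \<omega>) = 0"
    and "expectation (\<lambda>\<omega>. (B t \<omega> - B s \<omega>)\<^sup>2) = t - s"
    and "expectation (\<lambda>\<omega>. \<bar>B t \<omega> - B s \<omega>\<bar>) \<le> sqrt (t - s)"
    and "expectation (\<lambda>\<omega>. \<bar>B t \<omega> - B s \<omega>\<bar> ^ 3) \<le> 2 * sqrt (t - s) ^ 3"
proof -
  note D = distributed_integral[OF increment_distributed, symmetric]
  have pos: "0 < sqrt (t - s)" using st by simp
  have c: "sqrt (2 / pi) \<le> 1" using pi_ge_two by simp
  show "expectation (\<lambda>\<omega>. B t \<omega> - B s \<omega>) = 0"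
    using D[of "\<lambda>x. x"] integral_normal_moment_odd[OF pos, of 0 0] by simp
  show "expectation (\<lambda>\<omega>. (B t \<omega> - B s \<omega>)\<^sup>2) = t - s"
    using D[of "\<lambda>x. x\<^sup>2"] integral_normal_moment_even[OF pos, of 0 1] st by (simp add: power2_eq_square)
  have "expectation (\<lambda>\<omega>. \<bar>B t \<omega> - B s \<omega>\<bar>) = sqrt (t - s) * sqrt (2 / pi)"
    using D[of "\<lambda>x. \<bar>x\<bar>"] integral_normal_moment_abs_odd[OF pos, of 0 0] by simp
  also have "\<dots> \<le> sqrt (t - s) * 1" using c st by (intro mult_left_mono) auto
  finally show "expectation (\<lambda>\<omega>. \<bar>B t \<omega> - B s \<omega>\<bar>) \<le> sqrt (t - s)" by simp
  have "expectation (\<lambda>\<omega>. \<bar>B t \<omega> - B s \<omega>\<bar> ^ 3) = 2 * sqrt (t - s) ^ 3 * sqrt (2 / pi)"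
    using D[of "\<lambda>x. \<bar>x\<bar> ^ 3"] integral_normal_moment_abs_odd[OF pos, of 0 1] by (simp add: eval_nat_numeral)
  also have "\<dots> \<le> 2 * sqrt (t - s) ^ 3 * 1" using c st by (intro mult_left_mono) auto
  finally show "expectation (\<lambda>\<omega>. \<bar>B t \<omega> - B s \<omega>\<bar> ^ 3) \<le> 2 * sqrt (t - s) ^ 3" by simp
qed

lemma increment_independent:
  fixes V f :: "_ \<Rightarrow> real"
  assumes V: "V \<in> borel_measurable (F s)" and V_bound: "\<And>\<omega>. \<omega> \<in> space M \<Longrightarrow> \<bar>V \<omega>\<bar> \<le> K"
    and f [measurable]: "f \<in> borel_measurable borel"
    and int: "integrable M (\<lambda>\<omega>. f (B t \<omega> - B s \<omega>))"
  shows "integrable M (\<lambda>\<omega>. V \<omega> * f (B t \<omega> - B s \<omega>))"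
    and "expectation (\<lambda>\<omega>. V \<omega> * f (B t \<omega> - B s \<omega>)) = expectation V * expectation (\<lambda>\<omega>. f (B t \<omega> - B s \<omega>))"
proof -
  let ?W = "\<lambda>\<omega>. B t \<omega> - B s \<omega>"
  note [measurable] = increment_measurable
  have VM [measurable]: "V \<in> borel_measurable M" using measurable_F[OF st(1) V] .
  have ind: "indep_set (sets (F s)) (sets (vimage_algebra (space M) ?W borel))"
    using B st by (auto simp: brownian_motion_def)
  have "indep_var borel V borel ?W"
    unfolding indep_var_eq
  proof (intro conjI)
    have "sigma_sets (space M) {V -` A \<inter> space M |A. A \<in> sets borel} \<subseteq> sets (F s)"
      using sets.sigma_sets_subset[of "{V -` A \<inter> space M |A. A \<in> sets borel}" "F s"]
        measurable_sets[OF V] space_F[OF st(1)] by auto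
    moreover have "sigma_sets (space M) {?W -` A \<inter> space M |A. A \<in> sets borel}
        \<subseteq> sets (vimage_algebra (space M) ?W borel)"
      by (simp add: sets_vimage_algebra)
    ultimately have "case_bool (sigma_sets (space M) {V -` A \<inter> space M |A. A \<in> sets borel})
        (sigma_sets (space M) {?W -` A \<inter> space M |A. A \<in> sets borel}) i
      \<subseteq> case_bool (sets (F s)) (sets (vimage_algebra (space M) ?W borel)) i" for i
      by (cases i) auto
    then show "indep_set (sigma_sets (space M) {V -` A \<inter> space M |A. A \<in> sets borel})
        (sigma_sets (space M) {?W -` A \<inter> space M |A. A \<in> sets borel})"
      using ind unfolding indep_set_def by (blast intro: indep_sets_mono_sets)
  qed measurable
  from indep_var_compose[OF this, of "\<lambda>x. x" borel f borel]
  have ind2: "indep_var borel V borel (\<lambda>\<omega>. f (?W \<omega>))" by (simp add: comp_def)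
  have Vint: "integrable M V"
    by (rule integrable_const_bound[of _ K]) (use V_bound in auto)
  show "integrable M (\<lambda>\<omega>. V \<omega> * f (?W \<omega>))" by (rule indep_var_integrable[OF ind2 Vint int])
  show "expectation (\<lambda>\<omega>. V \<omega> * f (?W \<omega>)) = expectation V * expectation (\<lambda>\<omega>. f (?W \<omega>))"
    by (rule indep_var_lebesgue_integral[OF ind2 Vint int])
qed

end

end

section \<open>Oscillation of solutions of the equation with sign drift\<close>

text \<open>A fixed solution \<open>\<xi>\<close> of the stochastic differential equation, whose modulus is the reflected process.\<close>

locale sign_sde = filtered_prob_space +
  fixes B \<xi> :: "real \<Rightarrow> 'a \<Rightarrow> real" and \<mu> \<sigma> x :: real
  assumes B: "brownian_motion B" and \<xi>: "sde_solution B \<mu> \<sigma> x \<xi>" and \<sigma>_pos: "\<sigma> > 0"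
begin

lemma \<xi>_adapted: "0 \<le> t \<Longrightarrow> \<xi> t \<in> borel_measurable (F t)"
  using \<xi> by (auto simp: sde_solution_def adapted_def)

lemma \<xi>_measurable: "0 \<le> t \<Longrightarrow> \<xi> t \<in> borel_measurable M"
  using \<xi>_adapted measurable_F by blast

lemma \<xi>_continuous: "\<omega> \<in> space M \<Longrightarrow> continuous_on {0..} (\<lambda>t. \<xi> t \<omega>)"
  using \<xi> by (auto simp: sde_solution_def)

lemma \<xi>_0: "AE \<omega> in M. \<xi> 0 \<omega> = x"
proof -
  have "AE \<omega> in M. B 0 \<omega> = 0" using B by (auto simp: brownian_motion_def)
  moreover have "AE \<omega> in M. \<forall>t\<ge>0. \<xi> t \<omega> = x + \<mu> * (LBINT s:{0..t}. sgn (\<xi> s \<omega>)) + \<sigma> * B t \<omega>"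
    using \<xi> by (auto simp: sde_solution_def)
  ultimately show ?thesis
  proof eventually_elim
    case (elim \<omega>)
    have "(LBINT s:{0::real}. sgn (\<xi> s \<omega>)) = 0"
      unfolding set_lebesgue_integral_def
      by (rule integral_eq_zero_AE) (use AE_lborel_singleton[of 0] in \<open>auto elim!: eventually_mono\<close>)
    with elim(2)[rule_format, of 0] elim(1) show ?case by simp
  qed
qed

lemma sgn_integrable:
  assumes "\<omega> \<in> space M" "0 \<le> s" "A \<in> sets borel" "A \<subseteq> {s..t}"
  shows "set_integrable lborel A (\<lambda>r. sgn (\<xi> r \<omega>))"
proof -
  have "(\<lambda>r. indicator {0..} r *\<^sub>R \<xi> r \<omega>) \<in> borel_measurable borel"
    by (rule borel_measurable_continuous_on_indicator[OF _ \<xi>_continuous[OF assms(1)]]) simp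
  then have [measurable]: "(\<lambda>r. sgn (indicator {0..} r *\<^sub>R \<xi> r \<omega>)) \<in> borel_measurable borel" by measurable
  have "set_integrable lborel {s..t} (\<lambda>r. sgn (indicator {0..} r *\<^sub>R \<xi> r \<omega>))"
  proof (rule set_integrable_bound[of _ _ "\<lambda>_. 1::real"])
    show "set_integrable lborel {s..t} (\<lambda>_. 1::real)"
      unfolding set_integrable_def by (auto simp: emeasure_lborel_Icc_eq)
    show "set_borel_measurable lborel {s..t} (\<lambda>r. sgn (indicator {0..} r *\<^sub>R \<xi> r \<omega>))"
      unfolding set_borel_measurable_def by measurable
  qed (auto simp: sgn_if)
  then have "set_integrable lborel A (\<lambda>r. sgn (indicator {0..} r *\<^sub>R \<xi> r \<omega>))"
    using assms by (auto intro: set_integrable_subset)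
  then show ?thesis
    by (rule set_integrable_cong[THEN iffD1, rotated -1]) (use assms in auto)
qed

lemma \<xi>_increment:
  "AE \<omega> in M. \<forall>s t. 0 \<le> s \<longrightarrow> s \<le> t \<longrightarrow>
     \<xi> t \<omega> - \<xi> s \<omega> = \<mu> * (LBINT r:{s<..t}. sgn (\<xi> r \<omega>)) + \<sigma> * (B t \<omega> - B s \<omega>)"
proof -
  have "AE \<omega> in M. \<forall>t\<ge>0. \<xi> t \<omega> = x + \<mu> * (LBINT s:{0..t}. sgn (\<xi> s \<omega>)) + \<sigma> * B t \<omega>"
    using \<xi> by (auto simp: sde_solution_def)
  moreover have "AE \<omega> in M. \<omega> \<in> space M" by simp
  ultimately show ?thesis
  proof eventually_elim
    case (elim \<omega>)
    show ?case
    proof (intro allI impI)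
      fix s t :: real assume st: "0 \<le> s" "s \<le> t"
      have split: "{0..t} = {0..s} \<union> {s<..t}" using st by auto
      have "(LBINT r:{0..t}. sgn (\<xi> r \<omega>)) = (LBINT r:{0..s}. sgn (\<xi> r \<omega>)) + (LBINT r:{s<..t}. sgn (\<xi> r \<omega>))"
        unfolding split
      proof (rule set_integral_Un)
        show "set_integrable lborel {0..s} (\<lambda>r. sgn (\<xi> r \<omega>))"
          by (rule sgn_integrable[OF elim(2), of 0 _ s]) auto
        show "set_integrable lborel {s<..t} (\<lambda>r. sgn (\<xi> r \<omega>))"
          by (rule sgn_integrable[OF elim(2) st(1), of _ t]) auto
      qed auto
      then show "\<xi> t \<omega> - \<xi> s \<omega> = \<mu> * (LBINT r:{s<..t}. sgn (\<xi> r \<omega>)) + \<sigma> * (B t \<omega> - B s \<omega>)"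
        using elim(1) st by (simp add: algebra_simps)
    qed
  qed
qed

lemma drift_bound:
  assumes "\<omega> \<in> space M" "0 \<le> s" "s \<le> t"
  shows "\<bar>LBINT r:{s<..t}. sgn (\<xi> r \<omega>)\<bar> \<le> t - s"
proof -
  have i: "set_integrable lborel {s<..t} (\<lambda>r. sgn (\<xi> r \<omega>))" using assms by (intro sgn_integrable) auto
  have j: "integrable lborel (\<lambda>r. indicator {s<..t} r :: real)"
    using assms by auto
  have "norm (LBINT r:{s<..t}. sgn (\<xi> r \<omega>)) \<le> (LBINT r. indicator {s<..t} r)"
    unfolding set_lebesgue_integral_def
    by (rule Bochner_Integration.integral_norm_bound_integral[OF i[unfolded set_integrable_def] j])
       (auto simp: indicator_def sgn_if)
  then show ?thesis using assms by simp
qed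

lemma \<xi>_increment_expectation:
  assumes "0 \<le> s" "s < t"
  shows "(\<integral>\<^sup>+\<omega>. ennreal \<bar>\<xi> t \<omega> - \<xi> s \<omega>\<bar> \<partial>M) \<le> ennreal (\<bar>\<mu>\<bar> * (t - s) + \<sigma> * sqrt (t - s))"
proof -
  note [measurable] = increment_measurable[OF B assms]
  have i: "integrable M (\<lambda>\<omega>. \<bar>\<mu>\<bar> * (t - s) + \<sigma> * \<bar>B t \<omega> - B s \<omega>\<bar>)"
    using increment_moment_integrable[OF B assms, of 1] by auto
  have "AE \<omega> in M. \<omega> \<in> space M" by simp
  with \<xi>_increment have "AE \<omega> in M. \<bar>\<xi> t \<omega> - \<xi> s \<omega>\<bar> \<le> \<bar>\<mu>\<bar> * (t - s) + \<sigma> * \<bar>B t \<omega> - B s \<omega>\<bar>"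
  proof eventually_elim
    case (elim \<omega>)
    have "\<bar>\<xi> t \<omega> - \<xi> s \<omega>\<bar> \<le> \<bar>\<mu>\<bar> * \<bar>LBINT r:{s<..t}. sgn (\<xi> r \<omega>)\<bar> + \<sigma> * \<bar>B t \<omega> - B s \<omega>\<bar>"
      using elim(1)[rule_format, of s t] assms \<sigma>_pos
        abs_triangle_ineq[of "\<mu> * (LBINT r:{s<..t}. sgn (\<xi> r \<omega>))" "\<sigma> * (B t \<omega> - B s \<omega>)"]
      by (simp add: abs_mult)
    moreover have "\<bar>\<mu>\<bar> * \<bar>LBINT r:{s<..t}. sgn (\<xi> r \<omega>)\<bar> \<le> \<bar>\<mu>\<bar> * (t - s)"
      using drift_bound[OF elim(2), of s t] assms by (intro mult_left_mono) auto
    ultimately show ?case by linarith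
  qed
  then have "(\<integral>\<^sup>+\<omega>. ennreal \<bar>\<xi> t \<omega> - \<xi> s \<omega>\<bar> \<partial>M) \<le> (\<integral>\<^sup>+\<omega>. ennreal (\<bar>\<mu>\<bar> * (t - s) + \<sigma> * \<bar>B t \<omega> - B s \<omega>\<bar>) \<partial>M)"
    by (intro nn_integral_mono_AE) (auto elim!: eventually_mono intro: ennreal_leI)
  also have "\<dots> = ennreal (expectation (\<lambda>\<omega>. \<bar>\<mu>\<bar> * (t - s) + \<sigma> * \<bar>B t \<omega> - B s \<omega>\<bar>))"
    using i \<sigma>_pos assms by (intro nn_integral_eq_integral) auto
  also have "expectation (\<lambda>\<omega>. \<bar>\<mu>\<bar> * (t - s) + \<sigma> * \<bar>B t \<omega> - B s \<omega>\<bar>) = \<bar>\<mu>\<bar> * (t - s) + \<sigma> * expectation (\<lambda>\<omega>. \<bar>B t \<omega> - B s \<omega>\<bar>)"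
    using increment_moment_integrable[OF B assms, of 1] by (simp add: prob_space)
  also have "\<dots> \<le> \<bar>\<mu>\<bar> * (t - s) + \<sigma> * sqrt (t - s)"
    using increment_moments(3)[OF B assms] \<sigma>_pos by (intro add_left_mono mult_left_mono) auto
  finally show ?thesis by (simp add: ennreal_leI)
qed

lemma \<xi>_abs_integrable:
  assumes "\<omega> \<in> space M" "0 \<le> s"
  shows "set_integrable lborel {s<..t} (\<lambda>r. \<bar>\<xi> r \<omega> - \<xi> s \<omega>\<bar>)"
proof (rule set_integrable_subset[of _ "{s..t}"])
  have "continuous_on {s..t} (\<lambda>t. \<xi> t \<omega>)"
    by (rule continuous_on_subset[OF \<xi>_continuous[OF assms(1)]]) (use assms in auto)
  then show "set_integrable lborel {s..t} (\<lambda>r. \<bar>\<xi> r \<omega> - \<xi> s \<omega>\<bar>)"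
    unfolding set_integrable_def
    by (intro borel_integrable_compact) (auto intro!: continuous_intros)
qed auto

text \<open>
  Tonelli's theorem turns the bound on each increment into a bound of order \<open>h powr (3 / 2)\<close>
  on the expected time integral of \<open>\<bar>\<xi> s - \<xi> t\<bar>\<close> over one step.
\<close>

lemma \<xi>_oscillation:
  assumes t: "0 \<le> t" and h: "0 < h" "h \<le> 1"
  defines "J \<equiv> \<lambda>\<omega>. LBINT s:{t<..t+h}. \<bar>\<xi> s \<omega> - \<xi> t \<omega>\<bar>"
  shows "J \<in> borel_measurable M"
    and "(\<integral>\<^sup>+\<omega>. ennreal (J \<omega>) \<partial>M) \<le> ennreal ((\<bar>\<mu>\<bar> + \<sigma>) * sqrt h ^ 3)"
proof -
  interpret pair_sigma_finite M lborel ..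
  \<comment> \<open>Only times \<open>s \<ge> 0\<close> are controlled, hence the truncation \<open>max 0 s\<close>.\<close>
  have "(\<lambda>(\<omega>, s). \<xi> (max 0 s) \<omega>) \<in> borel_measurable (M \<Otimes>\<^sub>M borel)"
  proof (rule measurable_continuous_process)
    show "continuous_on UNIV (\<lambda>s. \<xi> (max 0 s) \<omega>)" if "\<omega> \<in> space M" for \<omega>
      by (rule continuous_on_compose2[OF \<xi>_continuous[OF that]]) (auto intro!: continuous_intros)
  qed (auto intro: \<xi>_measurable)
  then have m1: "(\<lambda>p. \<xi> (max 0 (snd p)) (fst p)) \<in> borel_measurable (M \<Otimes>\<^sub>M borel)"
    by (simp add: case_prod_beta')
  note [measurable] = \<xi>_measurable[OF t]
  have m2: "(\<lambda>p. indicator {t<..t+h} (snd p) * \<bar>\<xi> (max 0 (snd p)) (fst p) - \<xi> t (fst p)\<bar>)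
      \<in> borel_measurable (M \<Otimes>\<^sub>M borel)" (is "?g \<in> _")
    using m1 by measurable
  have m3: "?g \<in> borel_measurable (M \<Otimes>\<^sub>M lborel)" using m2
    by (subst measurable_cong_sets[OF sets_pair_measure_cong[OF refl sets_lborel] refl])
  have Jeq: "J \<omega> = (\<integral>s. ?g (\<omega>, s) \<partial>lborel)" for \<omega>
    unfolding J_def set_lebesgue_integral_def
    by (rule Bochner_Integration.integral_cong) (use t in \<open>auto simp: indicator_def max_def\<close>)
  show "J \<in> borel_measurable M" unfolding Jeq[abs_def]
    using m3 by (intro lborel.borel_measurable_lebesgue_integral) (simp add: case_prod_beta')
  have "(\<integral>\<^sup>+\<omega>. ennreal (J \<omega>) \<partial>M) = (\<integral>\<^sup>+\<omega>. (\<integral>\<^sup>+s. ennreal (?g (\<omega>, s)) \<partial>lborel) \<partial>M)"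
  proof (rule nn_integral_cong)
    fix \<omega> assume w: "\<omega> \<in> space M"
    have "integrable lborel (\<lambda>s. ?g (\<omega>, s))"
      using \<xi>_abs_integrable[OF w t, of "t+h"] unfolding set_integrable_def
      by (rule Bochner_Integration.integrable_cong[THEN iffD1, rotated -1])
         (use t in \<open>auto simp: indicator_def max_def\<close>)
    then show "ennreal (J \<omega>) = (\<integral>\<^sup>+s. ennreal (?g (\<omega>, s)) \<partial>lborel)"
      unfolding Jeq by (subst nn_integral_eq_integral) auto
  qed
  also have "\<dots> = (\<integral>\<^sup>+s. (\<integral>\<^sup>+\<omega>. ennreal (?g (\<omega>, s)) \<partial>M) \<partial>lborel)"
    using m3 by (intro Fubini'[symmetric]) (simp add: case_prod_beta')
  also have "\<dots> \<le> (\<integral>\<^sup>+s. ennreal (\<bar>\<mu>\<bar> * h + \<sigma> * sqrt h) * indicator {t<..t+h} s \<partial>lborel)"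
  proof (rule nn_integral_mono)
    fix s :: real
    show "(\<integral>\<^sup>+\<omega>. ennreal (?g (\<omega>, s)) \<partial>M) \<le> ennreal (\<bar>\<mu>\<bar> * h + \<sigma> * sqrt h) * indicator {t<..t+h} s"
    proof (cases "s \<in> {t<..t+h}")
      case True
      then have "(\<integral>\<^sup>+\<omega>. ennreal (?g (\<omega>, s)) \<partial>M) = (\<integral>\<^sup>+\<omega>. ennreal \<bar>\<xi> s \<omega> - \<xi> t \<omega>\<bar> \<partial>M)"
        using t by (intro nn_integral_cong) (auto simp: max_def)
      also have "\<dots> \<le> ennreal (\<bar>\<mu>\<bar> * (s - t) + \<sigma> * sqrt (s - t))"
        using True t by (intro \<xi>_increment_expectation) auto
      also have "\<dots> \<le> ennreal (\<bar>\<mu>\<bar> * h + \<sigma> * sqrt h)"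
        using True \<sigma>_pos by (intro ennreal_leI add_mono mult_left_mono) auto
      finally show ?thesis using True by simp
    qed auto
  qed
  also have "\<dots> = ennreal (\<bar>\<mu>\<bar> * h + \<sigma> * sqrt h) * ennreal h"
    using h by (simp add: nn_integral_cmult)
  also have "\<dots> = ennreal ((\<bar>\<mu>\<bar> * h + \<sigma> * sqrt h) * h)"
    using h \<sigma>_pos by (simp add: ennreal_mult'')
  also have "\<dots> \<le> ennreal ((\<bar>\<mu>\<bar> + \<sigma>) * sqrt h ^ 3)"
  proof (rule ennreal_leI)
    have q: "h = sqrt h * sqrt h" "sqrt h \<le> 1" using h by auto
    have "h \<le> sqrt h" using q h mult_left_mono[of "sqrt h" 1 "sqrt h"] by simp
    then have "\<bar>\<mu>\<bar> * h + \<sigma> * sqrt h \<le> (\<bar>\<mu>\<bar> + \<sigma>) * sqrt h"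
      using mult_left_mono[of h "sqrt h" "\<bar>\<mu>\<bar>"] by (simp add: algebra_simps)
    then have "(\<bar>\<mu>\<bar> * h + \<sigma> * sqrt h) * h \<le> (\<bar>\<mu>\<bar> + \<sigma>) * sqrt h * h"
      using h by (intro mult_right_mono) auto
    also have "\<dots> = (\<bar>\<mu>\<bar> + \<sigma>) * sqrt h ^ 3" using h by (simp add: power3_eq_cube mult.assoc)
    finally show "(\<bar>\<mu>\<bar> * h + \<sigma> * sqrt h) * h \<le> (\<bar>\<mu>\<bar> + \<sigma>) * sqrt h ^ 3" .
  qed
  finally show "(\<integral>\<^sup>+\<omega>. ennreal (J \<omega>) \<partial>M) \<le> ennreal ((\<bar>\<mu>\<bar> + \<sigma>) * sqrt h ^ 3)" .
qed

end

section \<open>The one-step estimate\<close>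

lemma exp_minus_bounds:
  fixes x :: real assumes "0 \<le> x"
  shows "\<bar>exp (- x) - 1\<bar> \<le> x" and "\<bar>exp (- x) - 1 + x\<bar> \<le> x\<^sup>2"
proof -
  have l: "1 - x \<le> exp (- x)" using exp_ge_add_one_self[of "- x"] by simp
  then show "\<bar>exp (- x) - 1\<bar> \<le> x" using assms by simp
  have "exp (- x) \<le> 1 / (1 + x)"
    using exp_ge_add_one_self[of x] assms by (simp add: exp_minus field_simps)
  also have "\<dots> \<le> 1 - x + x\<^sup>2"
  proof -
    have "(1 - x + x\<^sup>2) * (1 + x) = 1 + x ^ 3" by (simp add: algebra_simps power2_eq_square power3_eq_cube)
    then show ?thesis using assms by (simp add: divide_le_eq)
  qed
  finally show "\<bar>exp (- x) - 1 + x\<bar> \<le> x\<^sup>2" using l by simp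
qed

lemma abs_add_le_add: "\<bar>x\<bar> \<le> A \<Longrightarrow> \<bar>y\<bar> \<le> B \<Longrightarrow> \<bar>x + y\<bar> \<le> A + B" for x y :: real
  by linarith

lemma power3_sum_le:
  fixes x y :: real assumes "0 \<le> x" "0 \<le> y"
  shows "(x + y) ^ 3 \<le> 4 * (x ^ 3 + y ^ 3)"
proof -
  have "0 \<le> 3 * ((x + y) * (x - y)\<^sup>2)" using assms by simp
  also have "\<dots> = 4 * (x ^ 3 + y ^ 3) - (x + y) ^ 3"
    by (simp add: algebra_simps power2_eq_square power3_eq_cube)
  finally show ?thesis by simp
qed

text \<open>
  With \<open>q = sqrt h\<close> and \<open>w = \<bar>W\<bar>\<close> for a Brownian increment \<open>W\<close> over a step \<open>h \<le> 1\<close>, the monomials in the error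
  of the expansion are dominated by \<open>q ^ 3 + w ^ 3\<close>, whose expectation is of order \<open>h powr (3 / 2)\<close>.
\<close>

lemma cubic_scale_bounds:
  fixes q w :: real assumes q: "0 \<le> q" "q \<le> 1" and w: "0 \<le> w"
  defines "P \<equiv> q ^ 3 + w ^ 3"
  shows "(q\<^sup>2)\<^sup>2 \<le> P" "q\<^sup>2 * w \<le> P" "q\<^sup>2 * w\<^sup>2 \<le> P" "(q\<^sup>2) ^ 3 \<le> P"
proof -
  have *: "q\<^sup>2 * w \<le> P"
  proof (cases "w \<le> q")
    case True
    then have "q\<^sup>2 * w \<le> q\<^sup>2 * q" using q by (intro mult_left_mono) auto
    then show ?thesis using w by (simp add: P_def power3_eq_cube power2_eq_square add_increasing2)
  next
    case False
    then have "q\<^sup>2 * w \<le> w\<^sup>2 * w" using q w by (intro mult_right_mono power_mono) auto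
    then show ?thesis using q by (simp add: P_def power3_eq_cube power2_eq_square add_increasing)
  qed
  then show "q\<^sup>2 * w \<le> P" .
  have q3: "q ^ 3 \<le> P" "w ^ 3 \<le> P" using q w by (auto simp: P_def)
  show "(q\<^sup>2)\<^sup>2 \<le> P"
    using power_decreasing[of 3 4 q] q q3 by (simp add: power_mult[symmetric])
  show "(q\<^sup>2) ^ 3 \<le> P"
    using power_decreasing[of 3 6 q] q q3 by (simp add: power_mult[symmetric])
  show "q\<^sup>2 * w\<^sup>2 \<le> P"
  proof (cases "w \<le> q")
    case True
    have "q\<^sup>2 * w\<^sup>2 \<le> q\<^sup>2 * w"
      using True q w by (intro mult_left_mono) (auto simp: power2_eq_square mult_left_le)
    then show ?thesis using * by simp
  next
    case False
    have "q\<^sup>2 * w\<^sup>2 \<le> q * w\<^sup>2" using q by (intro mult_right_mono) (auto simp: power2_eq_square mult_left_le)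
    also have "\<dots> \<le> w * w\<^sup>2" using False by (intro mult_right_mono) auto
    finally show ?thesis using q3 by (simp add: power3_eq_cube power2_eq_square)
  qed
qed

text \<open>
  The pathwise one-step expansion.  Here \<open>y\<close> is the starting point, \<open>h = q\<^sup>2\<close> the step, \<open>D\<close> the
  contribution of the drift and \<open>W\<close> the Brownian increment; \<open>J\<close> bounds the error made by replacing
  the sign in the drift by its value at the start of the step.  The subtracted bracket is the part that has mean zero.
\<close>

lemma (in test_function) remainder_bound:
  assumes \<sigma>: "\<sigma> > 0" and \<theta>: "\<theta> \<ge> 0"
  defines "K \<equiv> 4 * C * (\<bar>\<mu>\<bar> ^ 3 + \<sigma> ^ 3) + \<theta> * (C * a * (\<bar>\<mu>\<bar> + \<sigma>) + C * (\<mu>\<^sup>2 + \<sigma>\<^sup>2))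
      + C / 2 * (\<mu>\<^sup>2 + 2 * \<sigma> * \<bar>\<mu>\<bar>) + \<theta>\<^sup>2 * C"
  assumes y: "\<bar>y\<bar> < a" and q: "0 \<le> q" "q \<le> 1"
    and D: "\<bar>D\<bar> \<le> \<bar>\<mu>\<bar> * q\<^sup>2" and J: "\<bar>u1 y * (D - \<mu> * sgn y * q\<^sup>2)\<bar> \<le> J"
  shows "\<bar>exp (- \<theta> * q\<^sup>2) * u (y + (D + \<sigma> * W)) - u y - (\<sigma> * u1 y * W + \<sigma>\<^sup>2 / 2 * u2 y * (W\<^sup>2 - q\<^sup>2))\<bar>
    \<le> K * (q ^ 3 + \<bar>W\<bar> ^ 3) + J"
proof -
  define d e h P where "d = D + \<sigma> * W" and "e = exp (- \<theta> * q\<^sup>2)" and "h = q\<^sup>2" and "P = q ^ 3 + \<bar>W\<bar> ^ 3"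
  note P = cubic_scale_bounds[OF q abs_ge_zero[of W], folded P_def h_def]
  have h: "0 \<le> h" by (simp add: h_def)
  have P0: "0 \<le> P" using q by (simp add: P_def)
  have WP: "\<bar>W\<bar> ^ 3 \<le> P" using q by (simp add: P_def)
  have a: "0 < a" using y by linarith
  have Dh: "\<bar>D\<bar> \<le> \<bar>\<mu>\<bar> * h" using D by (simp add: h_def)
  have u1: "\<bar>u1 y\<bar> \<le> C * a"
    using u1_bound[OF y] mult_left_mono[of "\<bar>y\<bar>" a C] y C_nonneg by linarith
  have d: "\<bar>d\<bar> \<le> \<bar>\<mu>\<bar> * h + \<sigma> * \<bar>W\<bar>"
    using abs_triangle_ineq[of D "\<sigma> * W"] Dh \<sigma> by (simp add: d_def abs_mult)
  have d3: "\<bar>d\<bar> ^ 3 \<le> 4 * (\<bar>\<mu>\<bar> ^ 3 + \<sigma> ^ 3) * P"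
  proof -
    have "\<bar>d\<bar> ^ 3 \<le> (\<bar>\<mu>\<bar> * h + \<sigma> * \<bar>W\<bar>) ^ 3" using d by (intro power_mono) auto
    also have "\<dots> \<le> 4 * ((\<bar>\<mu>\<bar> * h) ^ 3 + (\<sigma> * \<bar>W\<bar>) ^ 3)"
      using h \<sigma> by (intro power3_sum_le) auto
    also have "\<dots> = 4 * (\<bar>\<mu>\<bar> ^ 3 * h ^ 3 + \<sigma> ^ 3 * \<bar>W\<bar> ^ 3)" by (simp add: power_mult_distrib)
    also have "\<dots> \<le> 4 * (\<bar>\<mu>\<bar> ^ 3 * P + \<sigma> ^ 3 * P)"
      using P(4) WP \<sigma> by (intro mult_left_mono add_mono) auto
    finally show ?thesis by (simp add: algebra_simps)
  qed
  have d1: "h * \<bar>d\<bar> \<le> (\<bar>\<mu>\<bar> + \<sigma>) * P"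
  proof -
    have "h * \<bar>d\<bar> \<le> h * (\<bar>\<mu>\<bar> * h + \<sigma> * \<bar>W\<bar>)" using d h by (intro mult_left_mono) auto
    also have "\<dots> = \<bar>\<mu>\<bar> * h\<^sup>2 + \<sigma> * (h * \<bar>W\<bar>)" by (simp add: algebra_simps power2_eq_square)
    also have "\<dots> \<le> \<bar>\<mu>\<bar> * P + \<sigma> * P" using P \<sigma> by (intro mult_left_mono add_mono) auto
    finally show ?thesis by (simp add: algebra_simps)
  qed
  have h1: "h \<le> 1" using q by (simp add: h_def power_le_one)
  have D2: "D\<^sup>2 \<le> \<mu>\<^sup>2 * P"
  proof -
    have "D\<^sup>2 \<le> (\<bar>\<mu>\<bar> * h)\<^sup>2" using Dh power_mono[of "\<bar>D\<bar>" _ 2] by simp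
    also have "\<dots> = \<mu>\<^sup>2 * h\<^sup>2" by (simp add: power_mult_distrib)
    also have "\<dots> \<le> \<mu>\<^sup>2 * P" using P by (intro mult_left_mono) auto
    finally show ?thesis .
  qed
  have d2: "h * d\<^sup>2 \<le> 2 * (\<mu>\<^sup>2 + \<sigma>\<^sup>2) * P"
  proof -
    have "d\<^sup>2 \<le> 2 * D\<^sup>2 + 2 * (\<sigma>\<^sup>2 * W\<^sup>2)"
      using sum_squares_bound[of D "\<sigma> * W"] by (simp add: d_def power2_sum power_mult_distrib algebra_simps)
    then have "h * d\<^sup>2 \<le> h * (2 * D\<^sup>2 + 2 * (\<sigma>\<^sup>2 * W\<^sup>2))" using h by (intro mult_left_mono)
    also have "\<dots> = 2 * (h * D\<^sup>2) + 2 * (\<sigma>\<^sup>2 * (h * W\<^sup>2))" by (simp add: algebra_simps)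
    also have "\<dots> \<le> 2 * (\<mu>\<^sup>2 * P) + 2 * (\<sigma>\<^sup>2 * P)"
    proof -
      have "h * D\<^sup>2 \<le> 1 * D\<^sup>2" using h1 by (intro mult_right_mono) auto
      then have "h * D\<^sup>2 \<le> \<mu>\<^sup>2 * P" using D2 by simp
      moreover have "\<sigma>\<^sup>2 * (h * W\<^sup>2) \<le> \<sigma>\<^sup>2 * P" using P(3) by (intro mult_left_mono) auto
      ultimately show ?thesis by linarith
    qed
    finally show ?thesis by (simp add: algebra_simps)
  qed
  have DW: "\<bar>D * W\<bar> \<le> \<bar>\<mu>\<bar> * P"
  proof -
    have "\<bar>D * W\<bar> \<le> \<bar>\<mu>\<bar> * h * \<bar>W\<bar>" unfolding abs_mult using Dh by (intro mult_right_mono) auto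
    also have "\<dots> = \<bar>\<mu>\<bar> * (h * \<bar>W\<bar>)" by simp
    also have "\<dots> \<le> \<bar>\<mu>\<bar> * P" using P(2) by (intro mult_left_mono) auto
    finally show ?thesis .
  qed
  have "\<theta> * h \<ge> 0" using \<theta> h by simp
  note e = exp_minus_bounds[OF this]
  have e01: "0 \<le> e" "e \<le> 1" using \<open>\<theta> * h \<ge> 0\<close> by (auto simp: e_def h_def)
  have e1: "\<bar>e - 1\<bar> \<le> \<theta> * h" "\<bar>e - 1 + \<theta> * h\<bar> \<le> (\<theta> * h)\<^sup>2" using e by (auto simp: e_def h_def)
  define \<rho> where "\<rho> = u (y + d) - u y - u1 y * d - u2 y * d\<^sup>2 / 2"
  have t1: "\<bar>e * \<rho>\<bar> \<le> C * (4 * (\<bar>\<mu>\<bar> ^ 3 + \<sigma> ^ 3) * P)"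
  proof -
    have "\<bar>e * \<rho>\<bar> \<le> 1 * \<bar>\<rho>\<bar>" unfolding abs_mult using e01 by (intro mult_right_mono) auto
    also have "\<dots> \<le> C * \<bar>d\<bar> ^ 3" using Taylor[OF y, of d] by (simp add: \<rho>_def)
    also have "\<dots> \<le> C * (4 * (\<bar>\<mu>\<bar> ^ 3 + \<sigma> ^ 3) * P)" using d3 C_nonneg by (intro mult_left_mono)
    finally show ?thesis .
  qed
  have t2: "\<bar>(e - 1) * (u1 y * d)\<bar> \<le> \<theta> * (C * a * ((\<bar>\<mu>\<bar> + \<sigma>) * P))"
  proof -
    have "\<bar>(e - 1) * (u1 y * d)\<bar> \<le> (\<theta> * h) * (C * a * \<bar>d\<bar>)"
      unfolding abs_mult using e1 u1 \<open>\<theta> * h \<ge> 0\<close> a C_nonneg by (intro mult_mono) auto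
    also have "\<dots> = \<theta> * (C * a * (h * \<bar>d\<bar>))" by simp
    also have "\<dots> \<le> \<theta> * (C * a * ((\<bar>\<mu>\<bar> + \<sigma>) * P))"
      using d1 \<theta> C_nonneg a by (intro mult_left_mono) auto
    finally show ?thesis .
  qed
  have t3: "\<bar>(e - 1) * (u2 y * d\<^sup>2 / 2)\<bar> \<le> \<theta> * (C * ((\<mu>\<^sup>2 + \<sigma>\<^sup>2) * P))"
  proof -
    have "\<bar>(e - 1) * (u2 y * d\<^sup>2 / 2)\<bar> \<le> (\<theta> * h) * (C * d\<^sup>2 / 2)"
      unfolding abs_mult abs_divide using e1 u2_bound[OF y] \<open>\<theta> * h \<ge> 0\<close> C_nonneg
      by (intro mult_mono divide_right_mono) (auto intro: mult_right_mono)
    also have "\<dots> = \<theta> * (C * (h * d\<^sup>2 / 2))" by simp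
    also have "\<dots> \<le> \<theta> * (C * ((\<mu>\<^sup>2 + \<sigma>\<^sup>2) * P))"
      using d2 \<theta> C_nonneg by (intro mult_left_mono) (auto simp: algebra_simps)
    finally show ?thesis .
  qed
  have t4: "\<bar>u2 y / 2 * (D\<^sup>2 + 2 * \<sigma> * (D * W))\<bar> \<le> C / 2 * (\<mu>\<^sup>2 * P + 2 * \<sigma> * (\<bar>\<mu>\<bar> * P))"
  proof -
    have "\<bar>D\<^sup>2 + 2 * \<sigma> * (D * W)\<bar> \<le> D\<^sup>2 + 2 * \<sigma> * \<bar>D * W\<bar>"
      using abs_triangle_ineq[of "D\<^sup>2" "2 * \<sigma> * (D * W)"] \<sigma> by (simp add: abs_mult)
    also have "\<dots> \<le> \<mu>\<^sup>2 * P + 2 * \<sigma> * (\<bar>\<mu>\<bar> * P)"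
      using D2 DW \<sigma> by (intro add_mono mult_left_mono) auto
    finally show ?thesis
      unfolding abs_mult abs_divide using u2_bound[OF y] C_nonneg by (intro mult_mono divide_right_mono) auto
  qed
  have t5: "\<bar>(e - 1 + \<theta> * h) * u y\<bar> \<le> \<theta>\<^sup>2 * P * C"
  proof -
    have "\<bar>(e - 1 + \<theta> * h) * u y\<bar> \<le> (\<theta> * h)\<^sup>2 * C"
      unfolding abs_mult using e1 u_bound[of y] by (intro mult_mono) auto
    also have "\<dots> = \<theta>\<^sup>2 * h\<^sup>2 * C" by (simp add: power_mult_distrib)
    also have "\<dots> \<le> \<theta>\<^sup>2 * P * C" using P(1) C_nonneg by (intro mult_left_mono mult_right_mono) auto
    finally show ?thesis .
  qed
  have t6: "\<bar>u1 y * (D - \<mu> * sgn y * h)\<bar> \<le> J" using J by (simp add: h_def)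
  \<comment> \<open>Collect the terms by order; the generator equation cancels those of order \<open>h\<close>.\<close>
  define U where "U = u2 y / 2"
  have U: "u2 y * d\<^sup>2 / 2 = U * d\<^sup>2" "u2 y / 2 = U" "\<sigma>\<^sup>2 / 2 * u2 y = \<sigma>\<^sup>2 * U"
    by (simp_all add: U_def)
  have "\<sigma>\<^sup>2 * U = \<theta> * u y - \<mu> * sgn y * u1 y"
    using generator[OF y] by (simp add: U_def)
  then have "h * (\<sigma>\<^sup>2 * U) = h * (\<theta> * u y - \<mu> * sgn y * u1 y)" by simp
  then have eq: "e * u (y + d) - u y - (\<sigma> * u1 y * W + \<sigma>\<^sup>2 / 2 * u2 y * (W\<^sup>2 - h))
      = e * \<rho> + (e - 1) * (u1 y * d) + (e - 1) * (u2 y * d\<^sup>2 / 2) + u2 y / 2 * (D\<^sup>2 + 2 * \<sigma> * (D * W))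
        + (e - 1 + \<theta> * h) * u y + u1 y * (D - \<mu> * sgn y * h)"
    unfolding \<rho>_def U by (simp add: d_def algebra_simps power2_eq_square)
  have KP: "K * P = C * (4 * (\<bar>\<mu>\<bar> ^ 3 + \<sigma> ^ 3) * P) + \<theta> * (C * a * ((\<bar>\<mu>\<bar> + \<sigma>) * P))
      + \<theta> * (C * ((\<mu>\<^sup>2 + \<sigma>\<^sup>2) * P)) + C / 2 * (\<mu>\<^sup>2 * P + 2 * \<sigma> * (\<bar>\<mu>\<bar> * P)) + \<theta>\<^sup>2 * P * C"
    by (simp add: K_def algebra_simps)
  have "\<bar>e * u (y + d) - u y - (\<sigma> * u1 y * W + \<sigma>\<^sup>2 / 2 * u2 y * (W\<^sup>2 - h))\<bar> \<le> K * P + J"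
    unfolding eq KP by (intro abs_add_le_add t1 t2 t3 t4 t5 t6)
  then show ?thesis by (simp add: e_def d_def h_def P_def)
qed

text \<open>A solution started below the level \<open>a\<close>, together with a test function for that level.\<close>

locale sign_sde_test = sign_sde M F B \<xi> \<mu> \<sigma> x + test_function \<mu> \<sigma> \<theta> a C u u1 u2
  for M :: "'a measure" and F B \<xi> \<mu> \<sigma> x \<theta> a C u u1 u2 +
  assumes \<theta>_pos: "\<theta> > 0" and x: "0 \<le> x" "x < a"
begin

lemma u_measurable [measurable]: "u \<in> borel_measurable borel"
  using u_cont by (rule borel_measurable_continuous_onI)

text \<open>
  The jump of the drift at \<open>0\<close> is harmless because \<open>u1\<close> vanishes there: a sign change between \<open>t\<close>
  and \<open>s\<close> forces \<open>\<bar>\<xi> t\<bar> \<le> \<bar>\<xi> s - \<xi> t\<bar>\<close>.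
\<close>

lemma drift_error:
  assumes w: "\<omega> \<in> space M" and t: "0 \<le> t" "t \<le> t'" and y: "\<bar>\<xi> t \<omega>\<bar> < a"
  shows "\<bar>u1 (\<xi> t \<omega>) * ((LBINT s:{t<..t'}. sgn (\<xi> s \<omega>)) - sgn (\<xi> t \<omega>) * (t' - t))\<bar>
      \<le> 2 * C * (LBINT s:{t<..t'}. \<bar>\<xi> s \<omega> - \<xi> t \<omega>\<bar>)"
proof -
  let ?y = "\<xi> t \<omega>"
  have i1: "set_integrable lborel {t<..t'} (\<lambda>s. sgn (\<xi> s \<omega>))"
    using w t by (intro sgn_integrable[of \<omega> t _ t']) auto
  have i2: "set_integrable lborel {t<..t'} (\<lambda>s. sgn ?y)"
    unfolding set_integrable_def using t by auto
  have i3: "set_integrable lborel {t<..t'} (\<lambda>s. u1 ?y * (sgn (\<xi> s \<omega>) - sgn ?y))"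
    using i1 i2 by auto
  have i4: "set_integrable lborel {t<..t'} (\<lambda>s. 2 * C * \<bar>\<xi> s \<omega> - ?y\<bar>)"
    using \<xi>_abs_integrable[OF w t(1)] by auto
  have "u1 ?y * ((LBINT s:{t<..t'}. sgn (\<xi> s \<omega>)) - sgn ?y * (t' - t))
      = (LBINT s:{t<..t'}. u1 ?y * (sgn (\<xi> s \<omega>) - sgn ?y))"
    using i1 i2 t by (simp add: set_integral_diff set_integral_const)
  also have "norm \<dots> \<le> (LBINT s:{t<..t'}. 2 * C * \<bar>\<xi> s \<omega> - ?y\<bar>)"
    unfolding set_lebesgue_integral_def
  proof (rule Bochner_Integration.integral_norm_bound_integral[OF i3[unfolded set_integrable_def] i4[unfolded set_integrable_def]])
    fix s
    have "\<bar>u1 ?y * (sgn (\<xi> s \<omega>) - sgn ?y)\<bar> \<le> 2 * C * \<bar>\<xi> s \<omega> - ?y\<bar>"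
    proof (cases "sgn (\<xi> s \<omega>) = sgn ?y")
      case True
      then show ?thesis using C_nonneg by simp
    next
      case False
      then have "\<bar>?y\<bar> \<le> \<bar>\<xi> s \<omega> - ?y\<bar>" by (auto simp: sgn_if split: if_splits)
      then have "\<bar>u1 ?y\<bar> \<le> C * \<bar>\<xi> s \<omega> - ?y\<bar>"
        using u1_bound[OF y] mult_left_mono[OF _ C_nonneg] by fastforce
      moreover have "\<bar>sgn (\<xi> s \<omega>) - sgn ?y\<bar> \<le> 2" by (auto simp: sgn_if)
      ultimately have "\<bar>u1 ?y\<bar> * \<bar>sgn (\<xi> s \<omega>) - sgn ?y\<bar> \<le> (C * \<bar>\<xi> s \<omega> - ?y\<bar>) * 2"
        using C_nonneg by (intro mult_mono) auto
      then show ?thesis by (simp add: abs_mult mult_ac)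
    qed
    then show "norm (indicator {t<..t'} s *\<^sub>R (u1 ?y * (sgn (\<xi> s \<omega>) - sgn ?y))) \<le> indicator {t<..t'} s *\<^sub>R (2 * C * \<bar>\<xi> s \<omega> - ?y\<bar>)"
      by (auto simp: indicator_def)
  qed
  finally show ?thesis by simp
qed

text \<open>The constant depends neither on the time \<open>t\<close> nor on the conditioning event \<open>A\<close>.\<close>

lemma one_step_expectation:
  "\<exists>K\<ge>0. \<forall>t h A. 0 \<le> t \<longrightarrow> 0 < h \<longrightarrow> h \<le> 1 \<longrightarrow> A \<in> sets (F t) \<longrightarrow> (\<forall>\<omega>\<in>A. \<bar>\<xi> t \<omega>\<bar> < a) \<longrightarrow>
     \<bar>\<integral>\<omega>. indicator A \<omega> * (exp (- \<theta> * h) * u (\<xi> (t + h) \<omega>) - u (\<xi> t \<omega>)) \<partial>M\<bar> \<le> K * sqrt h ^ 3"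
proof -
  define K1 where "K1 = 4 * C * (\<bar>\<mu>\<bar> ^ 3 + \<sigma> ^ 3) + \<theta> * (C * a * (\<bar>\<mu>\<bar> + \<sigma>) + C * (\<mu>\<^sup>2 + \<sigma>\<^sup>2))
      + C / 2 * (\<mu>\<^sup>2 + 2 * \<sigma> * \<bar>\<mu>\<bar>) + \<theta>\<^sup>2 * C"
  define K2 where "K2 = 2 * C * \<bar>\<mu>\<bar>"
  have K: "0 \<le> K1" "0 \<le> K2"
    using C_nonneg \<sigma>_pos \<theta>_pos x unfolding K1_def K2_def by simp_all
  show ?thesis
  proof (intro exI[of _ "3 * K1 + K2 * (\<bar>\<mu>\<bar> + \<sigma>)"] conjI allI impI)
    show "0 \<le> 3 * K1 + K2 * (\<bar>\<mu>\<bar> + \<sigma>)" using K \<sigma>_pos by simp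
    fix t h :: real and A assume t: "0 \<le> t" and h: "0 < h" "h \<le> 1" and A: "A \<in> sets (F t)" and Aa: "\<forall>\<omega>\<in>A. \<bar>\<xi> t \<omega>\<bar> < a"
    define q where "q = sqrt h"
    have q: "0 \<le> q" "q \<le> 1" "q\<^sup>2 = h" using h by (auto simp: q_def)
    define W where "W \<omega> = B (t + h) \<omega> - B t \<omega>" for \<omega>
    have lt: "t < t + h" using h by simp
    note inc = increment_moments[OF B t lt, folded W_def, simplified]
    note int = increment_moment_integrable[OF B t lt, folded W_def]
    note [measurable] = \<xi>_measurable[OF t] increment_measurable[OF B t lt, folded W_def] sets_F[OF t A]
    have [measurable]: "\<xi> (t + h) \<in> borel_measurable M" using \<xi>_measurable[of "t+h"] t h by simp
    define J where "J \<omega> = (LBINT s:{t<..t+h}. \<bar>\<xi> s \<omega> - \<xi> t \<omega>\<bar>)" for \<omega>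
    have J [measurable]: "J \<in> borel_measurable M" and J_int: "(\<integral>\<^sup>+\<omega>. ennreal (J \<omega>) \<partial>M) \<le> ennreal ((\<bar>\<mu>\<bar> + \<sigma>) * q ^ 3)"
      using \<xi>_oscillation[OF t h] by (auto simp: J_def[abs_def] q_def)
    have J0: "0 \<le> J \<omega>" for \<omega> unfolding J_def set_lebesgue_integral_def by simp
    define V1 where "V1 \<omega> = indicator A \<omega> * u1 (\<xi> t \<omega>)" for \<omega>
    define V2 where "V2 \<omega> = indicator A \<omega> * u2 (\<xi> t \<omega>)" for \<omega>
    have V1: "V1 \<in> borel_measurable (F t)" and V2: "V2 \<in> borel_measurable (F t)"
      unfolding V1_def V2_def
      by (intro borel_measurable_times borel_measurable_indicator A
          measurable_compose[OF \<xi>_adapted[OF t]] u1_meas u2_meas)+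
    have V1b: "\<bar>V1 \<omega>\<bar> \<le> C * a" for \<omega>
    proof (cases "\<omega> \<in> A")
      case True
      then have y: "\<bar>\<xi> t \<omega>\<bar> < a" using Aa by auto
      show ?thesis using True u1_bound[OF y] mult_left_mono[of "\<bar>\<xi> t \<omega>\<bar>" a C] y C_nonneg by (simp add: V1_def)
    qed (use C_nonneg x in \<open>simp add: V1_def\<close>)
    have V2b: "\<bar>V2 \<omega>\<bar> \<le> C" for \<omega>
      using u2_bound[of "\<xi> t \<omega>"] Aa C_nonneg by (auto simp: V2_def indicator_def)
    \<comment> \<open>The mean-zero part of the increment.\<close>
    define M0 where "M0 \<omega> = \<sigma> * (V1 \<omega> * W \<omega>) + \<sigma>\<^sup>2 / 2 * (V2 \<omega> * ((W \<omega>)\<^sup>2 - h))" for \<omega>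
    have iW: "integrable M W" by (rule integrable_abs_cancel) (use int[of 1] in simp, measurable)
    have iW2: "integrable M (\<lambda>\<omega>. (W \<omega>)\<^sup>2)" using int[of 2] by simp
    note I1 = increment_independent[OF B t lt V1 V1b, of "\<lambda>x. x", folded W_def, OF _ iW]
    note I2 = increment_independent[OF B t lt V2 V2b, of "\<lambda>x. x\<^sup>2 - h", folded W_def]
    have iW2h: "integrable M (\<lambda>\<omega>. (W \<omega>)\<^sup>2 - h)" using iW2 by simp
    have eW2h: "expectation (\<lambda>\<omega>. (W \<omega>)\<^sup>2 - h) = 0" using iW2 inc(2) by (simp add: prob_space)
    have iM0: "integrable M M0" and eM0: "expectation M0 = 0"
      proof -
      have i1: "integrable M (\<lambda>\<omega>. V1 \<omega> * W \<omega>)" and e1: "expectation (\<lambda>\<omega>. V1 \<omega> * W \<omega>) = 0"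
        using I1 inc(1) by simp_all
      have i2: "integrable M (\<lambda>\<omega>. V2 \<omega> * ((W \<omega>)\<^sup>2 - h))" and e2: "expectation (\<lambda>\<omega>. V2 \<omega> * ((W \<omega>)\<^sup>2 - h)) = 0"
        using I2[OF _ iW2h] unfolding eW2h by simp_all
      show "integrable M M0" unfolding M0_def
        by (intro Bochner_Integration.integrable_add integrable_mult_right i1 i2)
      show "expectation M0 = 0" unfolding M0_def using i1 i2 e1 e2 by simp
    qed
    define Z where "Z \<omega> = indicator A \<omega> * (exp (- \<theta> * h) * u (\<xi> (t + h) \<omega>) - u (\<xi> t \<omega>))" for \<omega>
    have iZ: "integrable M Z"
    proof (rule integrable_const_bound[of _ "C + C"])
      have "\<bar>exp (- \<theta> * h) * u y\<bar> \<le> 1 * C" for y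
        unfolding abs_mult using u_bound[of y] \<theta>_pos h by (intro mult_mono) auto
      then have "\<bar>exp (- \<theta> * h) * u y - u z\<bar> \<le> C + C" for y z
        using abs_triangle_ineq4[of "exp (- \<theta> * h) * u y" "u z"] u_bound[of z] by (metis add_mono mult_1 order_trans)
      then show "AE \<omega> in M. norm (Z \<omega>) \<le> C + C"
        unfolding Z_def using C_nonneg by (intro AE_I2) (simp add: indicator_def)
      show "Z \<in> borel_measurable M" unfolding Z_def by measurable
    qed
    have AE: "AE \<omega> in M. \<bar>Z \<omega> - M0 \<omega>\<bar> \<le> K1 * (q ^ 3 + \<bar>W \<omega>\<bar> ^ 3) + K2 * J \<omega>"
    proof -
      have "AE \<omega> in M. \<omega> \<in> space M" by simp
      with \<xi>_increment show ?thesis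
      proof eventually_elim
        case (elim \<omega>)
        show ?case
        proof (cases "\<omega> \<in> A")
          case False
          then show ?thesis using K J0[of \<omega>] q by (simp add: Z_def M0_def V1_def V2_def)
        next
          case True
          define y D where "y = \<xi> t \<omega>" and "D = \<mu> * (LBINT r:{t<..t+h}. sgn (\<xi> r \<omega>))"
          have y: "\<bar>y\<bar> < a" using True Aa by (auto simp: y_def)
          have eq: "\<xi> (t + h) \<omega> = y + (D + \<sigma> * W \<omega>)"
            using elim(1)[rule_format, of t "t+h"] t h by (simp add: y_def D_def W_def)
          have D: "\<bar>D\<bar> \<le> \<bar>\<mu>\<bar> * q\<^sup>2"
            unfolding D_def abs_mult using drift_bound[OF elim(2) t, of "t+h"] h q(3) by (intro mult_left_mono) auto
          have "\<bar>\<mu>\<bar> * \<bar>u1 y * ((LBINT s:{t<..t+h}. sgn (\<xi> s \<omega>)) - sgn y * h)\<bar> \<le> \<bar>\<mu>\<bar> * (2 * C * J \<omega>)"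
            using drift_error[OF elim(2) t, of "t+h"] y h by (intro mult_left_mono) (auto simp: y_def J_def)
          then have "\<bar>u1 y * (D - \<mu> * sgn y * q\<^sup>2)\<bar> \<le> K2 * J \<omega>"
            by (simp add: D_def K2_def q(3) abs_mult[symmetric] algebra_simps)
          note bound = remainder_bound[OF \<sigma>_pos less_imp_le[OF \<theta>_pos] y q(1,2) D this, of "W \<omega>", folded K1_def, unfolded q(3)]
          have "Z \<omega> = exp (- \<theta> * h) * u (y + (D + \<sigma> * W \<omega>)) - u y"
            using True by (simp add: Z_def eq y_def)
          moreover have "M0 \<omega> = \<sigma> * u1 y * W \<omega> + \<sigma>\<^sup>2 / 2 * u2 y * ((W \<omega>)\<^sup>2 - h)"
            using True by (simp add: M0_def V1_def V2_def y_def)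
          ultimately show ?thesis using bound by simp
        qed
      qed
    qed
    have i3: "integrable M (\<lambda>\<omega>. K1 * (q ^ 3 + \<bar>W \<omega>\<bar> ^ 3))" using int[of 3] by auto
    have "ennreal (norm (\<integral>\<omega>. Z \<omega> - M0 \<omega> \<partial>M)) \<le> (\<integral>\<^sup>+\<omega>. norm (Z \<omega> - M0 \<omega>) \<partial>M)"
      using iZ iM0 by (intro integral_norm_bound_ennreal) auto
    also have "\<dots> \<le> (\<integral>\<^sup>+\<omega>. ennreal (K1 * (q ^ 3 + \<bar>W \<omega>\<bar> ^ 3)) + ennreal K2 * ennreal (J \<omega>) \<partial>M)"
          proof (rule nn_integral_mono_AE)
      show "AE \<omega> in M. ennreal (norm (Z \<omega> - M0 \<omega>)) \<le> ennreal (K1 * (q ^ 3 + \<bar>W \<omega>\<bar> ^ 3)) + ennreal K2 * ennreal (J \<omega>)"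
        using AE
      proof eventually_elim
        case (elim \<omega>)
        then have "ennreal (norm (Z \<omega> - M0 \<omega>)) \<le> ennreal (K1 * (q ^ 3 + \<bar>W \<omega>\<bar> ^ 3) + K2 * J \<omega>)"
          by (intro ennreal_leI) simp
        also have "\<dots> = ennreal (K1 * (q ^ 3 + \<bar>W \<omega>\<bar> ^ 3)) + ennreal K2 * ennreal (J \<omega>)"
          using K q J0[of \<omega>] by (simp add: ennreal_mult)
        finally show ?case .
      qed
    qed
    also have "\<dots> = (\<integral>\<^sup>+\<omega>. ennreal (K1 * (q ^ 3 + \<bar>W \<omega>\<bar> ^ 3)) \<partial>M) + ennreal K2 * (\<integral>\<^sup>+\<omega>. ennreal (J \<omega>) \<partial>M)"
      by (simp add: nn_integral_add nn_integral_cmult)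
    also have "(\<integral>\<^sup>+\<omega>. ennreal (K1 * (q ^ 3 + \<bar>W \<omega>\<bar> ^ 3)) \<partial>M) = ennreal (expectation (\<lambda>\<omega>. K1 * (q ^ 3 + \<bar>W \<omega>\<bar> ^ 3)))"
      using i3 K q by (intro nn_integral_eq_integral) auto
    also have "expectation (\<lambda>\<omega>. K1 * (q ^ 3 + \<bar>W \<omega>\<bar> ^ 3)) = K1 * (q ^ 3 + expectation (\<lambda>\<omega>. \<bar>W \<omega>\<bar> ^ 3))"
      using int[of 3] by (simp add: prob_space)
    also have "ennreal \<dots> + ennreal K2 * (\<integral>\<^sup>+\<omega>. ennreal (J \<omega>) \<partial>M) \<le> ennreal (K1 * (q ^ 3 + 2 * q ^ 3)) + ennreal K2 * ennreal ((\<bar>\<mu>\<bar> + \<sigma>) * q ^ 3)"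
      using inc(4) K J_int by (intro add_mono ennreal_leI mult_left_mono) (auto simp: q_def)
    also have "\<dots> = ennreal ((3 * K1 + K2 * (\<bar>\<mu>\<bar> + \<sigma>)) * q ^ 3)"
      using K q \<sigma>_pos by (simp add: ennreal_plus[symmetric] ennreal_mult[symmetric] algebra_simps del: ennreal_plus)
    finally have "\<bar>\<integral>\<omega>. Z \<omega> - M0 \<omega> \<partial>M\<bar> \<le> (3 * K1 + K2 * (\<bar>\<mu>\<bar> + \<sigma>)) * q ^ 3"
      using K q \<sigma>_pos by (subst (asm) ennreal_le_iff) auto
    moreover have "(\<integral>\<omega>. Z \<omega> - M0 \<omega> \<partial>M) = expectation Z" using iZ iM0 eM0 by simp
    ultimately show "\<bar>\<integral>\<omega>. indicator A \<omega> * (exp (- \<theta> * h) * u (\<xi> (t + h) \<omega>) - u (\<xi> t \<omega>)) \<partial>M\<bar>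
        \<le> (3 * K1 + K2 * (\<bar>\<mu>\<bar> + \<sigma>)) * sqrt h ^ 3"
      by (simp add: Z_def[abs_def] q_def)
  qed
qed

end

section \<open>Hitting times of continuous paths\<close>

lemma hitting_time_cong:
  assumes "\<And>t. 0 \<le> t \<Longrightarrow> X t \<omega> = Y t \<omega>"
  shows "hitting_time X a \<omega> = hitting_time Y a \<omega>"
proof -
  have "{t. 0 \<le> t \<and> X t \<omega> = a} = {t. 0 \<le> t \<and> Y t \<omega> = a}" using assms by auto
  then show ?thesis by (simp add: hitting_time_def)
qed

lemma hitting_time_cases:
  assumes cont: "continuous_on {0..} (\<lambda>t. X t \<omega>)"
  obtains (never) "hitting_time X a \<omega> = \<infinity>" "\<And>t. 0 \<le> t \<Longrightarrow> X t \<omega> \<noteq> a"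
  | (hit) t0 where "hitting_time X a \<omega> = ereal t0" "0 \<le> t0" "X t0 \<omega> = a"
      "\<And>t. 0 \<le> t \<Longrightarrow> t < t0 \<Longrightarrow> X t \<omega> \<noteq> a"
proof (cases "{t. 0 \<le> t \<and> X t \<omega> = a} = {}")
  case True
  show ?thesis
  proof (rule never)
    show "hitting_time X a \<omega> = \<infinity>" unfolding hitting_time_def True by (simp add: top_ereal_def)
  qed (use True in auto)
next
  case False
  let ?S = "{t. 0 \<le> t \<and> X t \<omega> = a}"
  have "closed ({0..} \<inter> (\<lambda>t. X t \<omega>) -` {a})"
    by (rule continuous_closed_preimage[OF cont]) auto
  moreover have "{0..} \<inter> (\<lambda>t. X t \<omega>) -` {a} = ?S" by auto
  ultimately have closed: "closed ?S" by simp
  have bdd: "bdd_below ?S" by (rule bdd_belowI[of _ 0]) auto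
  have mem: "Inf ?S \<in> ?S" by (rule closed_contains_Inf[OF False bdd closed])
  show ?thesis
  proof (rule hit[of "Inf ?S"])
    show "hitting_time X a \<omega> = ereal (Inf ?S)" unfolding hitting_time_def
    proof (rule antisym)
      show "Inf (ereal ` ?S) \<le> ereal (Inf ?S)" using mem by (intro Inf_lower) auto
      show "ereal (Inf ?S) \<le> Inf (ereal ` ?S)" by (intro Inf_greatest) (auto intro!: cInf_lower bdd)
    qed
    show "0 \<le> Inf ?S" "X (Inf ?S) \<omega> = a" using mem by auto
    fix t assume "0 \<le> t" "t < Inf ?S"
    then show "X t \<omega> \<noteq> a" using cInf_lower[OF _ bdd, of t] by fastforce
  qed
qed

lemma hitting_time_greater_iff:
  assumes "continuous_on {0..} (\<lambda>t. X t \<omega>)" "0 \<le> t"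
  shows "ereal t < hitting_time X a \<omega> \<longleftrightarrow> (\<forall>s\<in>{0..t}. X s \<omega> \<noteq> a)"
  using assms(1)
proof (cases rule: hitting_time_cases[of X \<omega> a])
  case never
  then show ?thesis by auto
next
  case (hit t0)
  show ?thesis
  proof (cases "t < t0")
    case True
    then show ?thesis using hit by auto
  next
    case False
    then show ?thesis using hit by (auto intro!: bexI[of _ t0])
  qed
qed

context sign_sde
begin

lemma abs_\<xi>_continuous: "\<omega> \<in> space M \<Longrightarrow> continuous_on {0..} (\<lambda>t. \<bar>\<xi> t \<omega>\<bar>)"
  using \<xi>_continuous by (intro continuous_intros)

text \<open>
  By compactness a path avoids the level \<open>a\<close> on \<open>[0, t]\<close> exactly if its modulus keeps a positive
  distance from \<open>a\<close> there, which can be tested at the countably many times \<open>t * q\<close> with \<open>q\<close> rational.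
\<close>

lemma avoidance_event:
  assumes t: "0 \<le> t"
  shows "{\<omega> \<in> space M. \<forall>s\<in>{0..t}. \<bar>\<xi> s \<omega>\<bar> \<noteq> a} \<in> sets (F t)"
proof -
  define Q where "Q = {0<..<1::real} \<inter> \<rat>"
  have clQ: "closure Q = {0..1}"
    unfolding Q_def by (subst closure_open_Int_superset) (auto simp: Rats_closure_real)
  have cQ: "countable Q" unfolding Q_def using countable_rat by (rule countable_subset[rotated]) auto
  have Q01: "q \<in> {0..1}" if "q \<in> Q" for q using that by (auto simp: Q_def)
  have Qne: "Q \<noteq> {}" using clQ by (metis closure_empty atLeastatMost_empty_iff zero_le_one not_less zero_less_one)
  have "{\<omega> \<in> space M. \<forall>s\<in>{0..t}. \<bar>\<xi> s \<omega>\<bar> \<noteq> a}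
      = (\<Union>n. \<Inter>q\<in>Q. {\<omega> \<in> space (F t). inverse (real (Suc n)) \<le> \<bar>\<bar>\<xi> (t * q) \<omega>\<bar> - a\<bar>})" (is "?L = ?R")
  proof (intro equalityI subsetI)
    fix \<omega> assume w: "\<omega> \<in> ?L"
    have "continuous_on {0..t} (\<lambda>s. \<bar>\<bar>\<xi> s \<omega>\<bar> - a\<bar>)"
      using continuous_on_subset[OF \<xi>_continuous, of \<omega> "{0..t}"] w by (auto intro!: continuous_intros)
    from continuous_attains_inf[OF _ _ this] t
    obtain s where s: "s \<in> {0..t}" "\<And>r. r \<in> {0..t} \<Longrightarrow> \<bar>\<bar>\<xi> s \<omega>\<bar> - a\<bar> \<le> \<bar>\<bar>\<xi> r \<omega>\<bar> - a\<bar>" by auto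
    have "0 < \<bar>\<bar>\<xi> s \<omega>\<bar> - a\<bar>" using w s by auto
    then obtain n where n: "inverse (real (Suc n)) < \<bar>\<bar>\<xi> s \<omega>\<bar> - a\<bar>" using reals_Archimedean by blast
    have "inverse (real (Suc n)) \<le> \<bar>\<bar>\<xi> (t * q) \<omega>\<bar> - a\<bar>" if "q \<in> Q" for q
      using s(2)[of "t * q"] n Q01[OF that] t by (auto simp: mult_left_le)
    then show "\<omega> \<in> ?R" using w space_F[OF t] by blast
  next
    fix \<omega> assume "\<omega> \<in> ?R"
    then obtain n where n: "\<And>q. q \<in> Q \<Longrightarrow> \<omega> \<in> space M \<and> inverse (real (Suc n)) \<le> \<bar>\<bar>\<xi> (t * q) \<omega>\<bar> - a\<bar>"
      using space_F[OF t] by auto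
    with Qne have w: "\<omega> \<in> space M" by blast
    have "\<bar>\<xi> s \<omega>\<bar> \<noteq> a" if s: "s \<in> {0..t}" for s
    proof -
      obtain v where v: "v \<in> {0..1}" "s = t * v"
        using s t by (cases "t = 0") (auto intro: that[of 0] that[of "s / t"])
      have "continuous_on (closure Q) (\<lambda>v. \<bar>\<bar>\<xi> (t * v) \<omega>\<bar> - a\<bar>)"
        unfolding clQ using t
        by (intro continuous_intros continuous_on_compose2[OF \<xi>_continuous[OF w]]) auto
      then have "inverse (real (Suc n)) \<le> \<bar>\<bar>\<xi> (t * v) \<omega>\<bar> - a\<bar>"
        by (rule continuous_ge_on_closure) (use v clQ n in auto)
      moreover have "0 < inverse (real (Suc n))" by simp
      ultimately show ?thesis using v by auto
    qed
    then show "\<omega> \<in> ?L" using w by auto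
  qed
  also have "\<dots> \<in> sets (F t)"
  proof (rule sets.countable_UN, clarify, rule sets.countable_INT'[OF cQ Qne], clarify)
    fix n q assume q: "q \<in> Q"
    have "\<xi> (t * q) \<in> borel_measurable (F t)"
      using Q01[OF q] t by (intro measurable_F_mono[OF _ _ \<xi>_adapted]) (auto simp: mult_left_le)
    then show "{\<omega> \<in> space (F t). inverse (real (Suc n)) \<le> \<bar>\<bar>\<xi> (t * q) \<omega>\<bar> - a\<bar>} \<in> sets (F t)" by measurable
  qed
  finally show ?thesis .
qed

lemma hitting_time_measurable:
  "(\<lambda>\<omega>. hitting_time (\<lambda>t \<omega>. \<bar>\<xi> t \<omega>\<bar>) a \<omega>) \<in> borel_measurable M" (is "?\<tau> \<in> _")
  unfolding borel_measurable_ereal_iff_Ioi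
proof
  fix c :: ereal
  show "?\<tau> -` {c<..} \<inter> space M \<in> sets M"
  proof (cases "c < 0")
    case True
    have "0 \<le> ?\<tau> \<omega>" for \<omega> unfolding hitting_time_def by (rule Inf_greatest) auto
    then have "?\<tau> -` {c<..} \<inter> space M = space M" using True by (auto intro: less_le_trans)
    then show ?thesis by simp
  next
    case False
    then consider "c = \<infinity>" | t where "c = ereal t" "0 \<le> t" by (cases c) auto
    then show ?thesis
    proof cases
      case 1
      then have "{c<..} = {}" by auto
      then show ?thesis by simp
    next
      case 2
      have "?\<tau> -` {c<..} \<inter> space M = {\<omega> \<in> space M. \<forall>s\<in>{0..t}. \<bar>\<xi> s \<omega>\<bar> \<noteq> a}"
        using hitting_time_greater_iff[of "\<lambda>t \<omega>. \<bar>\<xi> t \<omega>\<bar>" _ t a] abs_\<xi>_continuous 2 by auto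
      then show ?thesis using sets_F[OF 2(2) avoidance_event[OF 2(2)]] by simp
    qed
  qed
qed

lemma exp_discount_measurable:
  "(\<lambda>\<omega>. exp_discount \<theta> (hitting_time (\<lambda>t \<omega>. \<bar>\<xi> t \<omega>\<bar>) a \<omega>)) \<in> borel_measurable M"
proof -
  note [measurable] = hitting_time_measurable
  show ?thesis unfolding exp_discount_def by measurable
qed

end

section \<open>Stopping along a grid\<close>

lemma sum_indicator_telescope:
  fixes Y :: "nat \<Rightarrow> real"
  assumes "\<And>k. k \<in> K \<longleftrightarrow> k < \<kappa>"
  shows "(\<Sum>k<N. indicator K k * (Y (Suc k) - Y k)) = Y (min \<kappa> N) - Y 0"
proof (induction N)
  case (Suc N)
  show ?case
  proof (cases "N < \<kappa>")
    case True
    then show ?thesis using Suc assms[of N] by (simp add: min_absorb2)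
  next
    case False
    then show ?thesis using Suc assms[of N] by (simp add: min_absorb1)
  qed
qed simp

context sign_sde_test
begin

text \<open>
  The event that the level \<open>a\<close> has not been reached by time \<open>t\<close>.  The explicit requirement
  \<open>\<bar>\<xi> t \<omega>\<bar> < a\<close> is redundant for paths started at \<open>x < a\<close>; it excludes the exceptional paths that start
  above \<open>a\<close>, so that the one-step estimate applies on the whole event.
\<close>

definition survival :: "real \<Rightarrow> 'a set" where
  "survival t = {\<omega> \<in> space M. \<bar>\<xi> t \<omega>\<bar> < a \<and> (\<forall>s\<in>{0..t}. \<bar>\<xi> s \<omega>\<bar> \<noteq> a)}"

lemma survival_event: "0 \<le> t \<Longrightarrow> survival t \<in> sets (F t)"
proof -
  assume t: "0 \<le> t"
  note [measurable] = \<xi>_adapted[OF t]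
  have "{\<omega> \<in> space (F t). \<bar>\<xi> t \<omega>\<bar> < a} \<inter> {\<omega> \<in> space M. \<forall>s\<in>{0..t}. \<bar>\<xi> s \<omega>\<bar> \<noteq> a} \<in> sets (F t)"
    by (intro sets.Int avoidance_event t) measurable
  also have "{\<omega> \<in> space (F t). \<bar>\<xi> t \<omega>\<bar> < a} \<inter> {\<omega> \<in> space M. \<forall>s\<in>{0..t}. \<bar>\<xi> s \<omega>\<bar> \<noteq> a} = survival t"
    using space_F[OF t] by (auto simp: survival_def)
  finally show ?thesis .
qed

lemma survival_iff:
  assumes w: "\<omega> \<in> space M" and start: "\<xi> 0 \<omega> = x" and t: "0 \<le> t"
  shows "\<omega> \<in> survival t \<longleftrightarrow> ereal t < hitting_time (\<lambda>t \<omega>. \<bar>\<xi> t \<omega>\<bar>) a \<omega>"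
proof -
  have "\<bar>\<xi> t \<omega>\<bar> < a" if av: "\<forall>s\<in>{0..t}. \<bar>\<xi> s \<omega>\<bar> \<noteq> a"
  proof (rule ccontr)
    assume "\<not> \<bar>\<xi> t \<omega>\<bar> < a"
    then have "\<exists>s\<ge>0. s \<le> t \<and> \<bar>\<xi> s \<omega>\<bar> = a"
      using IVT'[of "\<lambda>s. \<bar>\<xi> s \<omega>\<bar>" 0 a t] x start t
        continuous_on_subset[OF abs_\<xi>_continuous[OF w], of "{0..t}"] by auto
    then show False using av by auto
  qed
  then show ?thesis
    unfolding hitting_time_greater_iff[of "\<lambda>t \<omega>. \<bar>\<xi> t \<omega>\<bar>", OF abs_\<xi>_continuous[OF w] t]
    using w by (auto simp: survival_def)
qed

text \<open>The discounted process.\<close>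

definition Y :: "real \<Rightarrow> 'a \<Rightarrow> real" where
  "Y t \<omega> = exp (- \<theta> * t) * u (\<xi> t \<omega>)"

text \<open>
  The discounted process on the grid of mesh \<open>h\<close>, stopped at the first grid time not before the
  hitting time of \<open>a\<close> or at step \<open>N\<close>, whichever comes first (see \<open>Z_stopped\<close>).  The definition as
  a sum of increments, each restricted to an event of the past, gives the expectation.
\<close>

definition Z :: "real \<Rightarrow> nat \<Rightarrow> 'a \<Rightarrow> real" where
  "Z h N \<omega> = Y 0 \<omega> +
     (\<Sum>k<N. indicator (survival (real k * h)) \<omega> * (Y (real (Suc k) * h) \<omega> - Y (real k * h) \<omega>))"

lemma Y_bound: "0 \<le> t \<Longrightarrow> \<bar>Y t \<omega>\<bar> \<le> exp (- \<theta> * t) * C"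
  unfolding Y_def abs_mult using u_bound by (intro mult_mono) auto

lemma Y_le: "0 \<le> t \<Longrightarrow> \<bar>Y t \<omega>\<bar> \<le> C"
proof -
  assume t: "0 \<le> t"
  have "exp (- \<theta> * t) * C \<le> 1 * C" using t \<theta>_pos C_nonneg by (intro mult_right_mono) auto
  then show ?thesis using Y_bound[OF t, of \<omega>] by linarith
qed

lemma Y_measurable: "0 \<le> t \<Longrightarrow> Y t \<in> borel_measurable M"
  unfolding Y_def using \<xi>_measurable[of t] by measurable

lemma Z_measurable: "0 < h \<Longrightarrow> Z h N \<in> borel_measurable M"
  unfolding Z_def
  by (intro borel_measurable_add borel_measurable_sum borel_measurable_times borel_measurable_diff
      borel_measurable_indicator sets_F[OF _ survival_event] Y_measurable) auto

lemma Z_expectation: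
  "\<exists>K\<ge>0. \<forall>h N. 0 < h \<longrightarrow> h \<le> 1 \<longrightarrow> \<bar>expectation (Z h N) - u x\<bar> \<le> real N * (K * sqrt h ^ 3)"
proof -
  obtain K where K: "K \<ge> 0" and step: "\<And>t h A. 0 \<le> t \<Longrightarrow> 0 < h \<Longrightarrow> h \<le> 1 \<Longrightarrow> A \<in> sets (F t) \<Longrightarrow>
      (\<forall>\<omega>\<in>A. \<bar>\<xi> t \<omega>\<bar> < a) \<Longrightarrow>
     \<bar>\<integral>\<omega>. indicator A \<omega> * (exp (- \<theta> * h) * u (\<xi> (t + h) \<omega>) - u (\<xi> t \<omega>)) \<partial>M\<bar> \<le> K * sqrt h ^ 3"
    using one_step_expectation by blast
  show ?thesis
  proof (intro exI[of _ K] conjI allI impI)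
    fix h :: real and N assume h: "0 < h" "h \<le> 1"
    let ?d = "\<lambda>k \<omega>. indicator (survival (real k * h)) \<omega> * (Y (real (Suc k) * h) \<omega> - Y (real k * h) \<omega>)"
    have int0: "integrable M (Y t)" if "0 \<le> t" for t
      by (rule integrable_const_bound[of _ C]) (use Y_le Y_measurable that in auto)
    have intd: "integrable M (?d k)" for k
    proof -
      have "integrable M (\<lambda>\<omega>. (Y (real (Suc k) * h) \<omega> - Y (real k * h) \<omega>) * indicator (survival (real k * h)) \<omega>)"
        using h by (intro integrable_real_mult_indicator Bochner_Integration.integrable_diff int0
            sets_F[OF _ survival_event]) auto
      then show ?thesis by (simp add: mult.commute)
    qed
    have e0: "expectation (Y 0) = u x"
    proof -
      have "expectation (Y 0) = expectation (\<lambda>_. u x)"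
        by (rule integral_cong_AE) (use \<xi>_0 Y_measurable[of 0] in \<open>auto elim!: eventually_mono simp: Y_def\<close>)
      then show ?thesis by (simp add: prob_space)
    qed
    have dk: "\<bar>expectation (?d k)\<bar> \<le> K * sqrt h ^ 3" for k
    proof -
      let ?t = "real k * h"
      let ?g = "\<lambda>\<omega>. indicator (survival ?t) \<omega> * (exp (- \<theta> * h) * u (\<xi> (?t + h) \<omega>) - u (\<xi> ?t \<omega>))"
      have t: "0 \<le> ?t" using h by simp
      have t': "real (Suc k) * h = ?t + h" by (simp add: algebra_simps)
      have "exp (- \<theta> * (?t + h)) = exp (- \<theta> * ?t) * exp (- \<theta> * h)"
        by (simp add: exp_add[symmetric] algebra_simps)
      then have "?d k = (\<lambda>\<omega>. exp (- \<theta> * ?t) * ?g \<omega>)"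
        unfolding Y_def t' by (intro ext) (simp only: right_diff_distrib mult_ac)
      then have "expectation (?d k) = expectation (\<lambda>\<omega>. exp (- \<theta> * ?t) * ?g \<omega>)" by (rule arg_cong)
      also have "\<dots> = exp (- \<theta> * ?t) * expectation ?g" by (rule integral_mult_right_zero)
      also have "\<bar>\<dots>\<bar> \<le> 1 * (K * sqrt h ^ 3)" unfolding abs_mult
        using \<theta>_pos t by (intro mult_mono step[OF t h survival_event[OF t]]) (auto simp: survival_def)
      finally show ?thesis by simp
    qed
    have "expectation (Z h N) = u x + (\<Sum>k<N. expectation (?d k))"
    proof -
      have "expectation (Z h N) = expectation (Y 0) + expectation (\<lambda>\<omega>. \<Sum>k<N. ?d k \<omega>)"
        unfolding Z_def
        by (rule Bochner_Integration.integral_add[OF int0[OF order_refl] Bochner_Integration.integrable_sum[OF intd]])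
      also have "expectation (\<lambda>\<omega>. \<Sum>k<N. ?d k \<omega>) = (\<Sum>k<N. expectation (?d k))"
        by (rule Bochner_Integration.integral_sum[OF intd])
      finally show ?thesis unfolding e0 .
    qed
    then have "\<bar>expectation (Z h N) - u x\<bar> = \<bar>\<Sum>k<N. expectation (?d k)\<bar>" by simp
    also have "\<dots> \<le> (\<Sum>k<N. \<bar>expectation (?d k)\<bar>)" by (rule sum_abs)
    also have "\<dots> \<le> (\<Sum>k<N. K * sqrt h ^ 3)" by (intro sum_mono dk)
    finally show "\<bar>expectation (Z h N) - u x\<bar> \<le> real N * (K * sqrt h ^ 3)" by simp
  qed (rule K)
qed

lemma Z_stopped:
  assumes w: "\<omega> \<in> space M" and start: "\<xi> 0 \<omega> = x" and h: "0 < h"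
    and \<kappa>: "\<And>k. ereal (real k * h) < hitting_time (\<lambda>t \<omega>. \<bar>\<xi> t \<omega>\<bar>) a \<omega> \<longleftrightarrow> k < \<kappa>"
  shows "Z h N \<omega> = Y (real (min \<kappa> N) * h) \<omega>"
proof -
  have "(\<Sum>k<N. indicator {k. \<omega> \<in> survival (real k * h)} k * (Y (real (Suc k) * h) \<omega> - Y (real k * h) \<omega>))
      = Y (real (min \<kappa> N) * h) \<omega> - Y (real 0 * h) \<omega>"
    using survival_iff[OF w start] \<kappa> h by (intro sum_indicator_telescope[of _ \<kappa> "\<lambda>k. Y (real k * h) \<omega>"]) auto
  then show ?thesis by (simp add: Z_def indicator_def)
qed

lemma Z_unstopped:
  assumes w: "\<omega> \<in> space M" and start: "\<xi> 0 \<omega> = x" and h: "0 < h"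
    and never: "hitting_time (\<lambda>t \<omega>. \<bar>\<xi> t \<omega>\<bar>) a \<omega> = \<infinity>"
  shows "Z h N \<omega> = Y (real N * h) \<omega>"
proof -
  have "Z h N \<omega> = Y 0 \<omega> + (\<Sum>k<N. Y (real (Suc k) * h) \<omega> - Y (real k * h) \<omega>)"
    unfolding Z_def using never survival_iff[OF w start] h by (auto intro!: sum.cong)
  also have "\<dots> = Y (real N * h) \<omega>"
    using sum_lessThan_telescope[of "\<lambda>k. Y (real k * h) \<omega>" N] by simp
  finally show ?thesis .
qed

lemma grid_hitting:
  assumes "0 < h" "0 \<le> t0"
  shows "real k * h < t0 \<longleftrightarrow> k < nat \<lceil>t0 / h\<rceil>"
proof -
  have "real k * h < t0 \<longleftrightarrow> real k < t0 / h" using assms by (simp add: less_divide_eq)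
  also have "\<dots> \<longleftrightarrow> k < nat \<lceil>t0 / h\<rceil>" by linarith
  finally show ?thesis .
qed

lemma Z_bound:
  assumes w: "\<omega> \<in> space M" and start: "\<xi> 0 \<omega> = x" and h: "0 < h"
  shows "\<bar>Z h N \<omega>\<bar> \<le> C"
  using abs_\<xi>_continuous[OF w]
proof (cases rule: hitting_time_cases[of "\<lambda>t \<omega>. \<bar>\<xi> t \<omega>\<bar>" \<omega> a])
  case never
  then show ?thesis using Z_unstopped[OF w start h] Y_le h by simp
next
  case (hit t0)
  have "Z h N \<omega> = Y (real (min (nat \<lceil>t0 / h\<rceil>) N) * h) \<omega>"
    by (rule Z_stopped[OF w start h]) (use hit grid_hitting[OF h] in auto)
  then show ?thesis using Y_le h by simp
qed

text \<open>The mesh tends to \<open>0\<close> while the horizon \<open>m ^ 5 * (1 / m ^ 4) = m\<close>, with \<open>m = Suc n\<close>, tends to infinity.\<close>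

lemma Z_limit:
  assumes w: "\<omega> \<in> space M" and start: "\<xi> 0 \<omega> = x" and even: "u (- a) = u a"
  shows "(\<lambda>n. Z (1 / real (Suc n) ^ 4) (Suc n ^ 5) \<omega>)
    \<longlonglongrightarrow> exp_discount \<theta> (hitting_time (\<lambda>t \<omega>. \<bar>\<xi> t \<omega>\<bar>) a \<omega>) * u a"
proof -
  define h where "h n = 1 / real (Suc n) ^ 4" for n
  define N where "N n = Suc n ^ 5" for n
  have h: "0 < h n" for n by (simp add: h_def)
  have Nh: "real (N n) * h n = real (Suc n)" for n
    unfolding N_def h_def of_nat_power by (simp add: power_eq_if[of _ 5] del: of_nat_Suc)
  have h0: "h \<longlonglongrightarrow> 0"
    unfolding h_def by real_asymp
  show ?thesis
    using abs_\<xi>_continuous[OF w]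
  proof (cases rule: hitting_time_cases[of "\<lambda>t \<omega>. \<bar>\<xi> t \<omega>\<bar>" \<omega> a])
    case never
    have Z: "Z (h n) (N n) \<omega> = Y (real (Suc n)) \<omega>" for n
      using Z_unstopped[OF w start h never(1)] unfolding Nh[symmetric] .
    have "(\<lambda>n. Z (h n) (N n) \<omega>) \<longlonglongrightarrow> 0"
      unfolding Z
    proof (rule Lim_null_comparison)
      show "\<forall>\<^sub>F n in sequentially. norm (Y (real (Suc n)) \<omega>) \<le> exp (- \<theta> * real (Suc n)) * C"
        using Y_bound by (intro always_eventually allI) simp
      show "(\<lambda>n. exp (- \<theta> * real (Suc n)) * C) \<longlonglongrightarrow> 0" using \<theta>_pos by real_asymp
    qed
    then show ?thesis using never \<theta>_pos by (simp add: exp_discount_def h_def N_def)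
  next
    case (hit t0)
    \<comment> \<open>The first grid time not before the hitting time.\<close>
    define s where "s n = real (nat \<lceil>t0 / h n\<rceil>) * h n" for n
    have s: "t0 \<le> s n" "s n \<le> t0 + h n" for n
    proof -
      have c: "t0 / h n \<le> real (nat \<lceil>t0 / h n\<rceil>)" "real (nat \<lceil>t0 / h n\<rceil>) \<le> t0 / h n + 1"
        using hit h[of n] by (auto simp: le_of_int_ceiling)
      show "t0 \<le> s n" using c(1) h[of n] by (simp add: s_def divide_le_eq)
      show "s n \<le> t0 + h n" using mult_right_mono[OF c(2), of "h n"] h[of n] by (simp add: s_def algebra_simps)
    qed
    have "s \<longlonglongrightarrow> t0"
    proof (rule real_tendsto_sandwich[of "\<lambda>_. t0" s _ "\<lambda>n. t0 + h n"])
      show "(\<lambda>n. t0 + h n) \<longlonglongrightarrow> t0" using tendsto_add[OF tendsto_const h0, of t0] by simp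
    qed (use s in auto)
    have "continuous_on {0..} (\<lambda>t. Y t \<omega>)"
      unfolding Y_def by (intro continuous_intros continuous_on_compose2[OF u_cont \<xi>_continuous[OF w]]) auto
    then have "(\<lambda>n. Y (s n) \<omega>) \<longlonglongrightarrow> Y t0 \<omega>"
      by (rule continuous_on_tendsto_compose[OF _ \<open>s \<longlonglongrightarrow> t0\<close>])
         (use hit s order_trans[OF hit(2) s(1)] in auto)
    moreover have "\<forall>\<^sub>F n in sequentially. Y (s n) \<omega> = Z (h n) (N n) \<omega>"
    proof -
      obtain n0 where n0: "t0 \<le> real n0" using real_arch_simple by blast
      show ?thesis
      proof (rule eventually_sequentiallyI)
        fix n assume "n0 \<le> n"
        then have "t0 \<le> real (N n) * h n" using n0 unfolding Nh by simp
        then have "t0 / h n \<le> real (N n)" using h[of n] by (simp add: divide_le_eq)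
        then have "nat \<lceil>t0 / h n\<rceil> \<le> N n" by (simp add: nat_le_iff ceiling_le_iff)
        moreover have "Z (h n) (N n) \<omega> = Y (real (min (nat \<lceil>t0 / h n\<rceil>) (N n)) * h n) \<omega>"
          by (rule Z_stopped[OF w start h]) (use hit grid_hitting[OF h] in auto)
        ultimately show "Y (s n) \<omega> = Z (h n) (N n) \<omega>" by (simp add: s_def min_def)
      qed
    qed
    ultimately have "(\<lambda>n. Z (h n) (N n) \<omega>) \<longlonglongrightarrow> Y t0 \<omega>" by (rule Lim_transform_eventually)
    moreover have "u (\<xi> t0 \<omega>) = u a" using hit(3) even by (auto simp: abs_if split: if_splits)
    ultimately show ?thesis using hit by (simp add: exp_discount_def Y_def h_def N_def)
  qed
qed

lemma Laplace_transform:
  assumes even: "u (- a) = u a"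
  shows "expectation (\<lambda>\<omega>. exp_discount \<theta> (hitting_time (\<lambda>t \<omega>. \<bar>\<xi> t \<omega>\<bar>) a \<omega>)) * u a = u x"
proof -
  let ?Z = "\<lambda>n. Z (1 / real (Suc n) ^ 4) (Suc n ^ 5)"
  let ?e = "\<lambda>\<omega>. exp_discount \<theta> (hitting_time (\<lambda>t \<omega>. \<bar>\<xi> t \<omega>\<bar>) a \<omega>)"
  have "(\<lambda>n. expectation (?Z n)) \<longlonglongrightarrow> expectation (\<lambda>\<omega>. ?e \<omega> * u a)"
  proof (rule integral_dominated_convergence[where w="\<lambda>_. C"])
    show "(\<lambda>\<omega>. ?e \<omega> * u a) \<in> borel_measurable M"
      using exp_discount_measurable by measurable
    show "?Z n \<in> borel_measurable M" for n by (rule Z_measurable) simp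
    show "AE \<omega> in M. (\<lambda>n. ?Z n \<omega>) \<longlonglongrightarrow> ?e \<omega> * u a"
      using \<xi>_0 AE_space[of M] by eventually_elim (rule Z_limit[OF _ _ even])
    show "AE \<omega> in M. norm (?Z n \<omega>) \<le> C" for n
      using \<xi>_0 AE_space[of M] by eventually_elim (simp add: Z_bound)
  qed simp
  moreover have "(\<lambda>n. expectation (?Z n)) \<longlonglongrightarrow> u x"
  proof -
    obtain K where K: "\<And>h N. 0 < h \<Longrightarrow> h \<le> 1 \<Longrightarrow> \<bar>expectation (Z h N) - u x\<bar> \<le> real N * (K * sqrt h ^ 3)"
      using Z_expectation by blast
    have "\<bar>expectation (?Z n) - u x\<bar> \<le> K / real (Suc n)" for n
    proof -
      let ?m = "real (Suc n)"
      have sq: "sqrt (1 / ?m ^ 4) = 1 / ?m ^ 2"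
      proof (rule real_sqrt_unique)
        have "?m ^ 4 = (?m ^ 2) ^ 2" by (simp only: power_mult[symmetric]) simp
        then show "(1 / ?m ^ 2) ^ 2 = 1 / ?m ^ 4" by (simp only: power_divide power_one)
      qed simp
      have "\<bar>expectation (?Z n) - u x\<bar> \<le> real (Suc n ^ 5) * (K * sqrt (1 / ?m ^ 4) ^ 3)"
        by (rule K) (simp_all add: one_le_power del: of_nat_Suc)
      also have "\<dots> = ?m ^ 5 * (K * (1 / ?m ^ 6))"
        unfolding sq of_nat_power power_divide power_one by (simp only: power_mult[symmetric]) simp
      also have "\<dots> = K / ?m" by (simp add: power_eq_if[of _ 6] del: of_nat_Suc)
      finally show ?thesis .
    qed
    then have "\<forall>\<^sub>F n in sequentially. norm (expectation (?Z n) - u x) \<le> K / real (Suc n)"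
      by (intro always_eventually) auto
    moreover have "(\<lambda>n. K / real (Suc n)) \<longlonglongrightarrow> 0" by real_asymp
    ultimately have "(\<lambda>n. expectation (?Z n) - u x) \<longlonglongrightarrow> 0"
      by (rule Lim_null_comparison)
    then show ?thesis by (rule LIM_zero_cancel)
  qed
  ultimately have "expectation (\<lambda>\<omega>. ?e \<omega> * u a) = u x" by (rule LIMSEQ_unique)
  then show ?thesis by simp
qed

end

section \<open>The Laplace transform of the hitting time\<close>

lemma hyperbolic_pos:
  fixes r \<mu> z :: real
  assumes "\<bar>\<mu>\<bar> \<le> r" "0 < r" "0 \<le> z"
  shows "0 < r * cosh z + \<mu> * sinh z"
proof -
  have "\<bar>\<mu>\<bar> * sinh z \<le> r * sinh z" using assms by (intro mult_right_mono) auto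
  also have "\<dots> < r * cosh z" using assms sinh_less_cosh_real by simp
  finally have "\<bar>\<mu>\<bar> * sinh z < r * cosh z" .
  moreover have "- (\<bar>\<mu>\<bar> * sinh z) \<le> \<mu> * sinh z"
    using mult_right_mono[of "- \<bar>\<mu>\<bar>" \<mu> "sinh z"] assms by simp
  ultimately show ?thesis by linarith
qed

text \<open>For \<open>\<theta> = 0\<close> the quantity \<open>r\<close> equals \<open>\<bar>\<mu>\<bar>\<close>, and numerator and denominator become exponentials.\<close>

lemma hyperbolic_zero_discount:
  fixes \<mu> z s :: real
  shows "\<bar>\<mu>\<bar> * cosh (z * \<bar>\<mu>\<bar> / s) + \<mu> * sinh (z * \<bar>\<mu>\<bar> / s) = \<bar>\<mu>\<bar> * exp (z * \<mu> / s)"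
proof -
  have "exp (z * \<mu> / s) = cosh (z * \<mu> / s) + sinh (z * \<mu> / s)" by (simp add: cosh_plus_sinh)
  then show ?thesis by (cases "\<mu> \<ge> 0") (simp_all add: algebra_simps)
qed

theorem theorem1p1:
  fixes M :: "'a measure" and F :: "real \<Rightarrow> 'a measure"
    and B X :: "real \<Rightarrow> 'a \<Rightarrow> real"
    and \<mu> \<sigma> x \<delta> \<theta> :: real
  assumes "filtered_prob_space M F"
    and "filtered_prob_space.brownian_motion M F B"
    and "\<sigma> > 0" and "x \<ge> 0" and "\<delta> \<ge> 0" and "\<theta> \<ge> 0"
    and "filtered_prob_space.reflected_brownian_motion M F B \<mu> \<sigma> x X"
  shows "(\<integral>\<omega>. exp_discount \<theta> (hitting_time X (x + \<delta>) \<omega>) \<partial>M) =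
    (if \<mu> = 0 \<and> \<theta> = 0 then 1
     else
       (let r = sqrt (\<mu>\<^sup>2 + 2 * \<theta> * \<sigma>\<^sup>2)
        in exp (\<delta> * \<mu> / \<sigma>\<^sup>2) *
           ((r * cosh (x * r / \<sigma>\<^sup>2) + \<mu> * sinh (x * r / \<sigma>\<^sup>2)) /
            (r * cosh ((x + \<delta>) * r / \<sigma>\<^sup>2) + \<mu> * sinh ((x + \<delta>) * r / \<sigma>\<^sup>2)))))"
proof -
  interpret filtered_prob_space M F by fact
  obtain \<xi> where \<xi>: "sde_solution B \<mu> \<sigma> x \<xi>" and X: "\<And>t \<omega>. 0 \<le> t \<Longrightarrow> \<omega> \<in> space M \<Longrightarrow> X t \<omega> = \<bar>\<xi> t \<omega>\<bar>"
    using assms(7) by (auto simp: reflected_brownian_motion_def)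
  interpret sign_sde M F B \<xi> \<mu> \<sigma> x
    by unfold_locales (use assms \<xi> in auto)
  define r where "r = sqrt (\<mu>\<^sup>2 + 2 * \<theta> * \<sigma>\<^sup>2)"
  let ?N = "\<lambda>y. r * cosh (y * r / \<sigma>\<^sup>2) + \<mu> * sinh (y * r / \<sigma>\<^sup>2)"
  let ?\<tau> = "hitting_time (\<lambda>t \<omega>. \<bar>\<xi> t \<omega>\<bar>) (x + \<delta>)"
  have hit: "(\<integral>\<omega>. exp_discount \<theta> (hitting_time X (x + \<delta>) \<omega>) \<partial>M) = (\<integral>\<omega>. exp_discount \<theta> (?\<tau> \<omega>) \<partial>M)"
    using X by (intro Bochner_Integration.integral_cong refl arg_cong[where f="exp_discount \<theta>"] hitting_time_cong) auto
  have r: "\<bar>\<mu>\<bar> \<le> r" unfolding r_def using assms by (intro real_le_rsqrt) simp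
  have Npos: "0 < ?N y" if "0 \<le> y" "r \<noteq> 0" for y
    using that r assms by (intro hyperbolic_pos) auto
  have "(\<integral>\<omega>. exp_discount \<theta> (?\<tau> \<omega>) \<partial>M) = (if \<mu> = 0 \<and> \<theta> = 0 then 1 else exp (\<delta> * \<mu> / \<sigma>\<^sup>2) * (?N x / ?N (x + \<delta>)))"
  proof (cases "\<theta> = 0")
    case True
    then have "exp_discount \<theta> t = 1" for t by (simp add: exp_discount_def)
    then have l: "(\<integral>\<omega>. exp_discount \<theta> (?\<tau> \<omega>) \<partial>M) = 1" by (simp add: prob_space)
    have r0: "r = \<bar>\<mu>\<bar>" using True by (simp add: r_def)
    have e: "exp (\<delta> * \<mu> / \<sigma>\<^sup>2) * (?N x / ?N (x + \<delta>)) = 1" if "\<mu> \<noteq> 0"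
      unfolding r0 hyperbolic_zero_discount using that
      by (simp add: exp_add[symmetric] divide_eq_eq add_divide_distrib[symmetric] algebra_simps)
    show ?thesis
    proof (cases "\<mu> = 0")
      case False
      then show ?thesis unfolding l e[OF False] by simp
    qed (use l True in simp)
  next
    case False
    then have \<theta>: "\<theta> > 0" using assms by simp
    then have r0: "r \<noteq> 0" using assms by (simp add: r_def add_nonneg_eq_0_iff)
    show ?thesis
    proof (cases "\<delta> = 0")
      case True
      have "AE \<omega> in M. exp_discount \<theta> (?\<tau> \<omega>) = 1"
        using \<xi>_0
      proof eventually_elim
        case (elim \<omega>)
        have "?\<tau> \<omega> = 0" unfolding hitting_time_def
        proof (rule antisym)
          show "Inf (ereal ` {t. 0 \<le> t \<and> \<bar>\<xi> t \<omega>\<bar> = x + \<delta>}) \<le> 0"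
            using elim True assms by (intro Inf_lower) (auto simp: zero_ereal_def)
        qed (auto intro!: Inf_greatest)
        then show ?case by (simp add: exp_discount_def)
      qed
      then have "(\<integral>\<omega>. exp_discount \<theta> (?\<tau> \<omega>) \<partial>M) = (\<integral>\<omega>. 1 \<partial>M)"
        using exp_discount_measurable by (intro integral_cong_AE) auto
      then show ?thesis using True \<theta> Npos[of x] r0 assms by (simp add: prob_space)
    next
      case False
      define a where "a = x + \<delta>"
      have a: "x < a" "0 < a" using False assms by (auto simp: a_def)
      obtain C u u1 u2 where tf: "test_function \<mu> \<sigma> \<theta> a C u u1 u2"
        and u: "\<And>y. \<bar>y\<bar> \<le> a \<Longrightarrow> u y = exp (- \<mu> * \<bar>y\<bar> / \<sigma>\<^sup>2) * (r * cosh (\<bar>y\<bar> * r / \<sigma>\<^sup>2) + \<mu> * sinh (\<bar>y\<bar> * r / \<sigma>\<^sup>2))"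
        using exists_test_function[OF \<open>\<sigma> > 0\<close> \<theta> a(2), of \<mu>] unfolding r_def by metis
      interpret test_function \<mu> \<sigma> \<theta> a C u u1 u2 by fact
      interpret sign_sde_test M F B \<xi> \<mu> \<sigma> x \<theta> a C u u1 u2
        by unfold_locales (use \<theta> a assms in auto)
      have "u (- a) = u a" using a by (simp add: u)
      from Laplace_transform[OF this]
      have "(\<integral>\<omega>. exp_discount \<theta> (?\<tau> \<omega>) \<partial>M) * u a = u x" by (simp add: a_def)
      moreover have "u a = exp (- \<mu> * a / \<sigma>\<^sup>2) * ?N a" "u x = exp (- \<mu> * x / \<sigma>\<^sup>2) * ?N x"
        using a assms by (simp_all add: u)
      moreover have "exp (- \<mu> * x / \<sigma>\<^sup>2) = exp (- \<mu> * a / \<sigma>\<^sup>2) * exp (\<delta> * \<mu> / \<sigma>\<^sup>2)"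
        by (simp add: exp_add[symmetric] a_def add_divide_distrib[symmetric] algebra_simps)
      ultimately have "(\<integral>\<omega>. exp_discount \<theta> (?\<tau> \<omega>) \<partial>M) * ?N a = exp (\<delta> * \<mu> / \<sigma>\<^sup>2) * ?N x" by simp
      then have "(\<integral>\<omega>. exp_discount \<theta> (?\<tau> \<omega>) \<partial>M) = exp (\<delta> * \<mu> / \<sigma>\<^sup>2) * (?N x / ?N a)"
        using Npos[of a] a r0 by (simp add: eq_divide_eq)
      then show ?thesis using \<theta> by (simp add: a_def)
    qed
  qed
  then show ?thesis unfolding hit r_def Let_def .
qed

end
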